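(* Fix an integer $M\ge1$ and run Yaroslavskiy's dual-pivot Quicksort with Insertionsort threshold $M$ (described in the context) on a uniformly random permutation of $\{1,\dots,n\}$. Let $S_n$ be the number of swaps performed in partitioning steps and $W_n$ the number of write accesses to the array (both as defined in the context). Then for $M\ge2$, as $n\to\infty$, \[ \mathbb{E}[S_n]=\tfrac35(n+1)\bigl(H_{n+1}-H_{M+2}\bigr)+\Bigl(\tfrac{19}{50}+\tfrac{4}{5(M+2)}\Bigr)(n+1)-\tfrac13+O(n^{-4}), \] \[ \mathbb{E}[W_n]=\tfrac{11}{10}(n+1)\bigl(H_{n+1}-H_{M+2}\bigr)+\Bigl(\tfrac{86}{75}+\tfrac{3}{20}M+\tfrac{18}{5(M+1)}-\tfrac{26}{5(M+2)}\Bigr)(n+1)-\tfrac56+O(n^{-4}), \] and for $M=1$ and all $n\ge4$, \[ \mathbb{E}[S_n]=\tfrac35(n+1)H_n-\tfrac{47}{100}n-\tfrac{61}{300},\qquad \mathbb{E}[W_n]=\tfrac{11}{10}(n+1)H_n-\tfrac{139}{200}n-\tfrac{257}{600}. \]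
   Context: $H_n=\sum_{i=1}^n 1/i$. Yaroslavskiy's dual-pivot Quicksort with Insertionsort threshold $M\ge1$ is the procedure $\mathrm{QS}(A,\mathit{left},\mathit{right})$ sorting $A[\mathit{left}..\mathit{right}]$, initially called as $\mathrm{QS}(A,1,n)$: (1) If $\mathit{right}-\mathit{left}<M$, run $\mathrm{InsertionSort}(A,\mathit{left},\mathit{right})$ and return. (2) Otherwise (a partitioning step): if $A[\mathit{left}]>A[\mathit{right}]$ set $p\gets A[\mathit{right}],q\gets A[\mathit{left}]$, else $p\gets A[\mathit{left}],q\gets A[\mathit{right}]$ (no array write). Set $\ell\gets\mathit{left}+1$, $g\gets\mathit{right}-1$, $k\gets\ell$. (3) While $k\le g$: (i) if $A[k]<p$: swap $A[k],A[\ell]$ and $\ell\gets\ell+1$; (ii) else if $A[k]\ge q$: while ($A[g]>q$ and $k<g$) do $g\gets g-1$; then if $A[g]\ge p$ swap $A[k],A[g]$ (a single swap), otherwise swap $A[k],A[g]$, then swap $A[k],A[\ell]$ (a double swap) and set $\ell\gets\ell+1$; finally $g\gets g-1$; (iii) $k\gets k+1$. (4) $\ell\gets\ell-1$, $g\gets g+1$; $A[\mathit{left}]\gets A[\ell]$, $A[\ell]\gets p$; $A[\mathit{right}]\gets A[g]$, $A[g]\gets q$. (5) Call $\mathrm{QS}(A,\mathit{left},\ell-1)$, $\mathrm{QS}(A,\ell+1,g-1)$, $\mathrm{QS}(A,g+1,\mathit{right})$. $\mathrm{InsertionSort}(A,\mathit{left},\mathit{right})$: for $i=\mathit{left}+1,\dots,\mathit{right}$: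 $j\gets i-1$, $v\gets A[i]$; while $j\ge\mathit{left}$ and $v<A[j]$: $A[j+1]\gets A[j]$, $j\gets j-1$; then $A[j+1]\gets v$. Swap count $S_n$: each executed swap in step (3) counts 1 (so the double swap counts 2), and each partitioning step contributes 2 further swaps for step (4); InsertionSort contributes no swaps. Write count $W_n$: each swap in (3)(i) and each single swap in (3)(ii) costs 2 writes, each double swap costs 3 writes, each partitioning step costs 4 writes for step (4), and each assignment $A[j+1]\gets A[j]$ or $A[j+1]\gets v$ in InsertionSort costs 1 write. *)

theory Defs
  imports "HOL-Probability.Probability" "HOL-Combinatorics.Permutations"
begin

text \<open>The algorithm runs on a state consisting of the array and the two cost counters.
  Arrays are total functions; on an initial call for \<open>1..n\<close> only these positions are accessed.\<close>

record state =
  arr :: "int \<Rightarrow> int"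
  swaps :: nat
  writes :: nat

definition charge :: "nat \<Rightarrow> nat \<Rightarrow> state \<Rightarrow> state" where
  "charge a b s = s\<lparr>swaps := swaps s + a, writes := writes s + b\<rparr>"

definition put :: "int \<Rightarrow> int \<Rightarrow> state \<Rightarrow> state" where
  "put i v s = charge 0 1 (s\<lparr>arr := (arr s)(i := v)\<rparr>)"

text \<open>Exchanging two entries is itself free of charge, since the write cost of a swap depends on
  whether it is part of a double swap.\<close>

definition exchange :: "int \<Rightarrow> int \<Rightarrow> state \<Rightarrow> state" where
  "exchange i j s = s\<lparr>arr := (arr s)(i := arr s j, j := arr s i)\<rparr>"

definition single_swap :: "int \<Rightarrow> int \<Rightarrow> state \<Rightarrow> state" where
  "single_swap i j s = charge 1 2 (exchange i j s)"

definition double_swap :: "int \<Rightarrow> int \<Rightarrow> int \<Rightarrow> state \<Rightarrow> state" where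
  "double_swap k g l s = charge 2 3 (exchange k l (exchange k g s))"


subsection \<open>Insertionsort\<close>

function insert_loop :: "int \<Rightarrow> int \<Rightarrow> int \<Rightarrow> state \<Rightarrow> state" where
  "insert_loop left v j s =
     (if j \<ge> left \<and> v < arr s j
      then insert_loop left v (j - 1) (put (j + 1) (arr s j) s)
      else put (j + 1) v s)"
  by auto
termination
  by (relation "Wellfounded.measure (\<lambda>(left, v, j, s). nat (j + 1 - left))") auto

definition insertion_sort :: "int \<Rightarrow> int \<Rightarrow> state \<Rightarrow> state" where
  "insertion_sort left right s =
     fold (\<lambda>i s. insert_loop left (arr s i) (i - 1) s) [left + 1..right] s"


subsection \<open>Partitioning\<close>

function scan_down :: "(int \<Rightarrow> int) \<Rightarrow> int \<Rightarrow> int \<Rightarrow> int \<Rightarrow> int" where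
  "scan_down A q k g = (if A g > q \<and> k < g then scan_down A q k (g - 1) else g)"
  by auto
termination
  by (relation "Wellfounded.measure (\<lambda>(A, q, k, g). nat (g - k))") auto

declare insert_loop.simps [simp del] scan_down.simps [simp del]

lemma scan_down_le: "scan_down A q k g \<le> g"
  by (induction A q k g rule: scan_down.induct) (subst scan_down.simps, auto)

lemma scan_down_ge: "k \<le> g \<Longrightarrow> k \<le> scan_down A q k g"
  by (induction A q k g rule: scan_down.induct) (subst scan_down.simps, auto)

text \<open>One iteration of the main while loop per call. A swap counts even if both positions coincide.\<close>

function partition_loop ::
    "int \<Rightarrow> int \<Rightarrow> int \<Rightarrow> int \<Rightarrow> int \<Rightarrow> state \<Rightarrow> int \<times> int \<times> state" where
  "partition_loop p q l k g s =
     (if k \<le> g then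
        if arr s k < p then
          partition_loop p q (l + 1) (k + 1) g (single_swap k l s)
        else if arr s k \<ge> q then
          let g = scan_down (arr s) q k g in
            if arr s g \<ge> p then
              partition_loop p q l (k + 1) (g - 1) (single_swap k g s)
            else
              partition_loop p q (l + 1) (k + 1) (g - 1) (double_swap k g l s)
        else
          partition_loop p q l (k + 1) g s
      else (l, g, s))"
  by auto
termination
proof (relation "Wellfounded.measure (\<lambda>(p, q, l, k, g, s). nat (g + 1 - k))", goal_cases)
  case (3 p q l k g s g')
  then show ?case using scan_down_le[of "arr s" q k g] by auto
next
  case (4 p q l k g s g')
  then show ?case using scan_down_le[of "arr s" q k g] by auto
qed auto

declare partition_loop.simps [simp del]

text \<open>Moving the two pivots into place counts as two swaps; its four writes are charged by
  \<open>put\<close>.\<close>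

definition partition_step :: "int \<Rightarrow> int \<Rightarrow> state \<Rightarrow> int \<times> int \<times> state" where
  "partition_step left right s =
     (let (p, q) = (if arr s left > arr s right then (arr s right, arr s left)
                    else (arr s left, arr s right));
          (l, g, s) = partition_loop p q (left + 1) (left + 1) (right - 1) s;
          l = l - 1;
          g = g + 1;
          s = put left (arr s l) s;
          s = put l p s;
          s = put right (arr s g) s;
          s = put g q s
      in (l, g, charge 2 0 s))"


subsection \<open>Quicksort\<close>

lemma partition_loop_bounds:
  assumes "partition_loop p q l k g s = (l', g', s')" "l \<le> k" "k \<le> g + 2"
  shows "l \<le> l' \<and> l' \<le> max k (g + 1) \<and> g' \<le> g \<and> min g (k - 2) \<le> g'"
  using assms
proof (induction p q l k g s rule: partition_loop.induct)
  case (1 p q l k g s)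
  show ?case
  proof (cases "k \<le> g")
    case False
    then show ?thesis using "1.prems" by (simp add: partition_loop.simps)
  next
    case True
    define h where "h = scan_down (arr s) q k g"
    have h: "h \<le> g" "k \<le> h"
      using scan_down_le scan_down_ge True by (auto simp: h_def Let_def)
    consider (a) "arr s k < p" | (b) "\<not> arr s k < p" "arr s k \<ge> q" "arr s h \<ge> p"
      | (c) "\<not> arr s k < p" "arr s k \<ge> q" "\<not> arr s h \<ge> p"
      | (d) "\<not> arr s k < p" "\<not> arr s k \<ge> q"
      by blast
    then show ?thesis
    proof cases
      case a
      then have "partition_loop p q (l + 1) (k + 1) g (single_swap k l s) = (l', g', s')"
        using "1.prems"(1) True by (subst (asm) partition_loop.simps) auto
      from "1.IH"(1)[OF True a this] show ?thesis using "1.prems" True by auto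
    next
      case b
      then have "partition_loop p q l (k + 1) (h - 1) (single_swap k h s) = (l', g', s')"
        using "1.prems"(1) True by (subst (asm) partition_loop.simps) (auto simp: h_def Let_def)
      from "1.IH"(2)[OF True b(1,2) h_def b(3) this] show ?thesis
        using "1.prems" True h by auto
    next
      case c
      then have "partition_loop p q (l + 1) (k + 1) (h - 1) (double_swap k h l s) = (l', g', s')"
        using "1.prems"(1) True by (subst (asm) partition_loop.simps) (auto simp: h_def Let_def)
      from "1.IH"(3)[OF True c(1,2) h_def c(3) this] show ?thesis
        using "1.prems" True h by auto
    next
      case d
      then have "partition_loop p q l (k + 1) g s = (l', g', s')"
        using "1.prems"(1) True by (subst (asm) partition_loop.simps) auto
      from "1.IH"(4)[OF True d this] show ?thesis using "1.prems" True by auto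
    qed
  qed
qed

lemma partition_step_bounds:
  assumes "partition_step left right s = (l, g, s')" "left \<le> right"
  shows "left \<le> l \<and> l \<le> right \<and> left \<le> g \<and> g \<le> right"
proof -
  obtain p q where pq: "(if arr s left > arr s right then (arr s right, arr s left)
                    else (arr s left, arr s right)) = (p, q)" by fastforce
  obtain l1 g1 s1 where pl:
    "partition_loop p q (left + 1) (left + 1) (right - 1) s = (l1, g1, s1)"
    using prod_cases3 by blast
  have "l = l1 - 1" "g = g1 + 1"
    using assms(1) by (auto simp: partition_step_def pq pl Let_def)
  then show ?thesis using partition_loop_bounds[OF pl] assms(2) by auto
qed

function quicksort :: "nat \<Rightarrow> int \<Rightarrow> int \<Rightarrow> state \<Rightarrow> state" where
  "quicksort M left right s =
     (if right - left < int M then insertion_sort left right s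
      else let (l, g, s) = partition_step left right s;
               s = quicksort M left (l - 1) s;
               s = quicksort M (l + 1) (g - 1) s
           in quicksort M (g + 1) right s)"
  by auto
termination
proof (relation "Wellfounded.measure (\<lambda>(M, left, right, s). nat (right + 1 - left))", goal_cases)
  case 1
  show ?case by simp
next
  case (2 M left right s x l y g s')
  then show ?case using partition_step_bounds[of left right s l g s'] by auto
next
  case (3 M left right s x l y g s')
  then show ?case using partition_step_bounds[of left right s l g s'] by auto
next
  case (4 M left right s x l y g s')
  then show ?case using partition_step_bounds[of left right s l g s'] by auto
qed

declare quicksort.simps [simp del]

definition run_quicksort :: "nat \<Rightarrow> nat \<Rightarrow> (int \<Rightarrow> int) \<Rightarrow> state" where
  "run_quicksort M n A = quicksort M 1 (int n) \<lparr>arr = A, swaps = 0, writes = 0\<rparr>"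

definition random_perm :: "nat \<Rightarrow> (int \<Rightarrow> int) pmf" where
  "random_perm n = pmf_of_set {\<pi>. \<pi> permutes {1..int n}}"

definition expected_swaps :: "nat \<Rightarrow> nat \<Rightarrow> real" where
  "expected_swaps M n =
     measure_pmf.expectation (random_perm n) (\<lambda>\<pi>. real (swaps (run_quicksort M n \<pi>)))"

definition expected_writes :: "nat \<Rightarrow> nat \<Rightarrow> real" where
  "expected_writes M n =
     measure_pmf.expectation (random_perm n) (\<lambda>\<pi>. real (writes (run_quicksort M n \<pi>)))"

end

theory Submission
  imports Defs
begin

text \<open>Partitioning compares elements only with the two pivots, so relabelling the small, the medium
  or the large elements among themselves before a partitioning step has the same effect as doing so
  afterwards. Averaging over these relabellings shows that each of the three subarrays is again in
  uniformly random order, and the mean cost satisfies a linear recurrence in \<open>n\<close>. The large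
  elements met by the index \<open>k\<close> are those in a prefix of the array whose length depends only on the
  ranks of the pivots, which gives their mean number and the toll function, linear for
  \<open>n \<ge> 3\<close>. Differencing the recurrence twice leaves a second-order one with a particular
  solution of the stated form; its homogeneous solutions are \<open>n + 1\<close> and
  \<open>1 / (n (n - 1) (n - 2) (n - 3))\<close>, and the two initial values fix the coefficient of \<open>n + 1\<close>.\<close>

subsection \<open>Relabelling and locality\<close>

text \<open>Randomness is handled by finite sums over relabellings instead of conditional
  distributions. An input is written \<open>\<tau> \<circ> A\<close>, where \<open>A\<close> is
  injective on an arbitrary interval and \<open>\<tau>\<close> permutes the set of its values.
  Relabelling is then composition on the left, and the induction can be applied to a subarray
  exactly as a partitioning step leaves it. Two kinds of relabelling occur. Inside one class of
  values the control flow is unchanged, which is what the recursive calls need. Among all values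
  other than the pivots the control flow does change, but the final pivot positions do not, and this
  suffices for the mean cost of the step. The obstacle for the writes is the double swap: a step
  makes twice as many writes as swaps, less one for each double swap. The double swaps are counted
  by the small elements that the index \<open>g\<close> meets. The case M = 1 is exact because its
  toll is linear only from 3 elements on. The recurrence is therefore started at n = 3, where the
  factor n - 3 vanishes, and the decaying homogeneous solution is absent altogether.\<close>

text \<open>On \<open>I\<close> the array of \<open>t\<close> is that of \<open>s\<close> with its values relabelled by \<open>\<tau>\<close>; identity \<open>\<tau>\<close> gives
  locality.\<close>

definition sim :: "(int \<Rightarrow> int) \<Rightarrow> int set \<Rightarrow> int \<Rightarrow> int \<Rightarrow> state \<Rightarrow> state \<Rightarrow> bool" where
  "sim \<tau> I a b s t \<longleftrightarrow> (\<forall>i\<in>I. arr t i = \<tau> (arr s i)) \<and>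
     int (swaps t) = int (swaps s) + a \<and> int (writes t) = int (writes s) + b"

lemma sim_arr: "sim \<tau> I a b s t \<Longrightarrow> i \<in> I \<Longrightarrow> arr t i = \<tau> (arr s i)"
  by (simp add: sim_def)

lemma sim_mono: "sim \<tau> I a b s t \<Longrightarrow> J \<subseteq> I \<Longrightarrow> sim \<tau> J a b s t"
  by (auto simp: sim_def)

lemma sim_put: "sim \<tau> I a b s t \<Longrightarrow> w = \<tau> v \<Longrightarrow> sim \<tau> I a b (put i v s) (put i w t)"
  by (auto simp: sim_def put_def charge_def)

lemma sim_charge: "sim \<tau> I a b s t \<Longrightarrow> sim \<tau> I a b (charge x y s) (charge x y t)"
  by (auto simp: sim_def charge_def)

lemma sim_exchange:
  "sim \<tau> I a b s t \<Longrightarrow> i \<in> I \<Longrightarrow> j \<in> I \<Longrightarrow> sim \<tau> I a b (exchange i j s) (exchange i j t)"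
  by (auto simp: sim_def exchange_def)

text \<open>A frame rule: two runs confined to \<open>J\<close> cannot disturb the agreement on the
  rest of \<open>I\<close>. It joins the agreement on the segments of the successive recursive
  calls.\<close>

lemma sim_extend:
  assumes "sim \<tau> J a b s' t'" "sim \<tau> I c d s t"
    and "\<And>i. i \<notin> J \<Longrightarrow> arr s' i = arr s i" "\<And>i. i \<notin> J \<Longrightarrow> arr t' i = arr t i"
  shows "sim \<tau> I a b s' t'"
  using assms unfolding sim_def by metis

lemma scan_down_sim:
  assumes "\<And>i. k \<le> i \<Longrightarrow> i \<le> g \<Longrightarrow> (B i > q) = (A i > q)" "k \<le> g"
  shows "scan_down B q k g = scan_down A q k g"
  using assms
proof (induction A q k g rule: scan_down.induct)
  case (1 A q k g)
  show ?case
  proof (cases "A g > q \<and> k < g")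
    case True
    then have "scan_down B q k (g - 1) = scan_down A q k (g - 1)"
      using 1 by auto
    then show ?thesis using 1(2)[of g] True
      by (subst (1 2) scan_down.simps) auto
  next
    case False
    then show ?thesis using 1(2)[of g] 1(3)
      by (subst (1 2) scan_down.simps) auto
  qed
qed

text \<open>Every branch tests an entry against \<open>p\<close> or \<open>q\<close>, and entries
  are only moved, so both runs take the same branches and corresponding entries stay at equal
  positions. The numbers \<open>a\<close> and \<open>b\<close> are the constant offsets between the
  counters.\<close>

lemma partition_loop_sim:
  assumes "sim \<tau> {lo..hi} a b s t"
    and "\<And>x. (\<tau> x < p) = (x < p)" "\<And>x. (\<tau> x < q) = (x < q)" "\<And>x. (\<tau> x > q) = (x > q)"
    and "lo \<le> l" "l \<le> k" "g \<le> hi"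
    and "partition_loop p q l k g s = (l', g', s')"
  shows "\<exists>t'. partition_loop p q l k g t = (l', g', t') \<and> sim \<tau> {lo..hi} a b s' t'"
  using assms
proof (induction p q l k g s arbitrary: t rule: partition_loop.induct)
  case (1 p q l k g s)
  note ord = "1.prems"(2-4)
  show ?case
  proof (cases "k \<le> g")
    case False
    then show ?thesis using "1.prems" by (simp add: partition_loop.simps)
  next
    case True
    define h where "h = scan_down (arr s) q k g"
    have h: "h \<le> g" "k \<le> h"
      using scan_down_le scan_down_ge True by (auto simp: h_def)
    have arr: "arr t i = \<tau> (arr s i)" if "lo \<le> i" "i \<le> hi" for i
      using sim_arr[OF "1.prems"(1)] that by auto
    have h': "scan_down (arr t) q k g = h" unfolding h_def
      using "1.prems" True by (intro scan_down_sim) (auto simp: arr)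
    have k: "(arr t k < p) = (arr s k < p)" "(arr t k < q) = (arr s k < q)"
      "(arr t h < p) = (arr s h < p)"
      using "1.prems" True h by (auto simp: arr)
    consider (a) "arr s k < p" | (b) "\<not> arr s k < p" "arr s k \<ge> q" "arr s h \<ge> p"
      | (c) "\<not> arr s k < p" "arr s k \<ge> q" "\<not> arr s h \<ge> p"
      | (d) "\<not> arr s k < p" "\<not> arr s k \<ge> q"
      by blast
    then show ?thesis
    proof cases
      case a
      have e: "partition_loop p q l k g u = partition_loop p q (l + 1) (k + 1) g (single_swap k l u)"
        if "arr u k < p" for u
        using True that by (subst partition_loop.simps) auto
      have "sim \<tau> {lo..hi} a b (single_swap k l s) (single_swap k l t)"
        unfolding single_swap_def using "1.prems" True
        by (intro sim_charge sim_exchange) auto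
      then show ?thesis using "1.IH"(1)[OF True a _ ord] "1.prems" a k by (auto simp: e)
    next
      case b
      have e: "partition_loop p q l k g u = partition_loop p q l (k + 1) (h - 1) (single_swap k h u)"
        if "\<not> arr u k < p" "arr u k \<ge> q" "arr u h \<ge> p" "scan_down (arr u) q k g = h" for u
        using True that by (subst partition_loop.simps) (auto simp: Let_def)
      have "sim \<tau> {lo..hi} a b (single_swap k h s) (single_swap k h t)"
        unfolding single_swap_def using "1.prems" True h
        by (intro sim_charge sim_exchange) auto
      then show ?thesis using "1.IH"(2)[OF True b(1,2) h_def b(3) _ ord] "1.prems" b k h h' h_def
        by (auto simp: e)
    next
      case c
      have e: "partition_loop p q l k g u = partition_loop p q (l + 1) (k + 1) (h - 1) (double_swap k h l u)"
        if "\<not> arr u k < p" "arr u k \<ge> q" "\<not> arr u h \<ge> p" "scan_down (arr u) q k g = h" for u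
        using True that by (subst partition_loop.simps) (auto simp: Let_def)
      have "sim \<tau> {lo..hi} a b (double_swap k h l s) (double_swap k h l t)"
        unfolding double_swap_def using "1.prems" True h
        by (intro sim_charge sim_exchange) auto
      then show ?thesis using "1.IH"(3)[OF True c(1,2) h_def c(3) _ ord] "1.prems" c k h h' h_def
        by (auto simp: e)
    next
      case d
      have e: "partition_loop p q l k g u = partition_loop p q l (k + 1) g u"
        if "\<not> arr u k < p" "\<not> arr u k \<ge> q" for u
        using True that by (subst partition_loop.simps) auto
      then show ?thesis using "1.IH"(4)[OF True d "1.prems"(1) ord] "1.prems" d k by (auto simp: e)
    qed
  qed
qed

lemma partition_step_eq:
  assumes "partition_loop (min (arr s left) (arr s right)) (max (arr s left) (arr s right))
             (left + 1) (left + 1) (right - 1) s = (l, g, s')"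
  shows "partition_step left right s = (l - 1, g + 1, charge 2 0
    (put (g + 1) (max (arr s left) (arr s right))
      (put right (arr (put (l - 1) (min (arr s left) (arr s right)) (put left (arr s' (l - 1)) s')) (g + 1))
        (put (l - 1) (min (arr s left) (arr s right)) (put left (arr s' (l - 1)) s')))))"
proof -
  have "(if arr s left > arr s right then (arr s right, arr s left) else (arr s left, arr s right)) =
    (min (arr s left) (arr s right), max (arr s left) (arr s right))"
    by auto
  then show ?thesis using assms by (simp add: partition_step_def Let_def)
qed

lemma partition_step_sim:
  assumes s: "sim \<tau> {left..right} a b s t" and lr: "left \<le> right"
    and p: "p = min (arr s left) (arr s right)" "\<tau> p = p"
    and q: "q = max (arr s left) (arr s right)" "\<tau> q = q"
    and ord: "\<And>x. (\<tau> x < p) = (x < p)" "\<And>x. (\<tau> x < q) = (x < q)" "\<And>x. (\<tau> x > q) = (x > q)"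
    and res: "partition_step left right s = (l, g, s')"
  shows "\<exists>t'. partition_step left right t = (l, g, t') \<and> sim \<tau> {left..right} a b s' t'"
proof -
  have t: "arr t left = arr s left" "arr t right = arr s right"
    using s lr p q by (auto simp: sim_def min_def max_def split: if_splits)
  obtain l1 g1 s1 where pl:
    "partition_loop p q (left + 1) (left + 1) (right - 1) s = (l1, g1, s1)"
    using prod_cases3 by blast
  from partition_loop_sim[OF s ord _ _ _ pl] obtain t1 where
    t1: "partition_loop p q (left + 1) (left + 1) (right - 1) t = (l1, g1, t1)"
      "sim \<tau> {left..right} a b s1 t1" by auto
  note step = partition_step_eq[of s left right, folded p(1) q(1), OF pl]
  note step' = partition_step_eq[of t left right, unfolded t, folded p(1) q(1), OF t1(1)]
  have lg: "l = l1 - 1" "g = g1 + 1"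
    using step res by auto
  have b: "l \<in> {left..right}" "g \<in> {left..right}"
    using partition_step_bounds[OF res lr] by auto
  have res': "s' = charge 2 0 (put g q (put right (arr (put l p (put left (arr s1 l) s1)) g)
      (put l p (put left (arr s1 l) s1))))"
    using step res by auto
  have "sim \<tau> {left..right} a b s' (charge 2 0 (put g q (put right
      (arr (put l p (put left (arr t1 l) t1)) g) (put l p (put left (arr t1 l) t1)))))"
    (is "sim _ _ _ _ _ ?t'")
  proof -
    have 1: "sim \<tau> {left..right} a b (put l p (put left (arr s1 l) s1)) (put l p (put left (arr t1 l) t1))"
      using t1(2) b p by (intro sim_put) (auto intro: sim_arr)
    show ?thesis unfolding res'
      by (intro sim_charge sim_put[OF sim_put[OF 1]] sim_arr[OF 1] b) (use q in simp)
  qed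
  moreover have "partition_step left right t = (l, g, ?t')"
    using step' by (simp add: lg)
  ultimately show ?thesis by auto
qed

section \<open>Effect of the elementary operations on array and counters\<close>

lemma arr_charge [simp]: "arr (charge a b s) = arr s"
  and swaps_charge [simp]: "swaps (charge a b s) = swaps s + a"
  and writes_charge [simp]: "writes (charge a b s) = writes s + b"
  by (auto simp: charge_def)

lemma arr_put [simp]: "arr (put i v s) = (arr s)(i := v)"
  and swaps_put [simp]: "swaps (put i v s) = swaps s"
  and writes_put [simp]: "writes (put i v s) = writes s + 1"
  by (auto simp: put_def charge_def)

lemma arr_exchange: "arr (exchange i j s) = arr s \<circ> Transposition.transpose i j"
  and swaps_exchange [simp]: "swaps (exchange i j s) = swaps s"
  and writes_exchange [simp]: "writes (exchange i j s) = writes s"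
  by (auto simp: exchange_def fun_eq_iff Transposition.transpose_def)

lemma arr_single_swap: "arr (single_swap i j s) = arr s \<circ> Transposition.transpose i j"
  and swaps_single_swap [simp]: "swaps (single_swap i j s) = swaps s + 1"
  and writes_single_swap [simp]: "writes (single_swap i j s) = writes s + 2"
  by (auto simp: single_swap_def arr_exchange)

lemma arr_double_swap: "arr (double_swap k g l s) = arr s \<circ> Transposition.transpose k g \<circ> Transposition.transpose k l"
  and swaps_double_swap [simp]: "swaps (double_swap k g l s) = swaps s + 2"
  and writes_double_swap [simp]: "writes (double_swap k g l s) = writes s + 3"
  by (auto simp: double_swap_def arr_exchange)

section \<open>Locality of Insertionsort and Quicksort\<close>

lemma insert_loop_outside:
  assumes "left \<le> j + 1" "i \<notin> {left..j+1}"
  shows "arr (insert_loop left v j s) i = arr s i"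
  using assms
proof (induction left v j s rule: insert_loop.induct)
  case (1 left v j s)
  then show ?case by (subst insert_loop.simps) auto
qed

text \<open>Insertionsort compares entries with one another and not with fixed pivots, so from here
  on \<open>sim\<close> is carried through with the identity relabelling.\<close>

lemma insert_loop_sim:
  assumes "sim (\<lambda>x. x) {left..right} a b s t" "left \<le> j + 1" "j + 1 \<le> right"
  shows "sim (\<lambda>x. x) {left..right} a b (insert_loop left v j s) (insert_loop left v j t)"
  using assms
proof (induction left v j s arbitrary: t rule: insert_loop.induct)
  case (1 left v j s)
  show ?case
  proof (cases "j \<ge> left \<and> v < arr s j")
    case True
    have e: "arr t j = arr s j" using sim_arr[OF "1.prems"(1), of j] True "1.prems" by auto
    have "sim (\<lambda>x. x) {left..right} a b (put (j + 1) (arr s j) s) (put (j + 1) (arr t j) t)"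
      using "1.prems" e by (intro sim_put) auto
    from "1.IH"[OF True this] show ?thesis using True "1.prems" e
      by (subst (1 2) insert_loop.simps) auto
  next
    case False
    have "\<not> (j \<ge> left \<and> v < arr t j)" using sim_arr[OF "1.prems"(1), of j] False "1.prems" by auto
    then show ?thesis using False "1.prems" 
      by (subst (1 2) insert_loop.simps) (auto intro: sim_put)
  qed
qed

lemma insertion_sort_outside:
  assumes "i \<notin> {left..right}"
  shows "arr (insertion_sort left right s) i = arr s i"
proof -
  have "arr (fold (\<lambda>i s. insert_loop left (arr s i) (i - 1) s) xs s) i = arr s i"
    if "set xs \<subseteq> {left+1..right}" for xs
    using that
  proof (induction xs arbitrary: s)
    case (Cons x xs)
    then show ?case using assms by (auto simp: insert_loop_outside)
  qed auto
  then show ?thesis by (auto simp: insertion_sort_def)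
qed

lemma insertion_sort_sim:
  assumes "sim (\<lambda>x. x) {left..right} a b s t"
  shows "sim (\<lambda>x. x) {left..right} a b (insertion_sort left right s) (insertion_sort left right t)"
proof -
  let ?f = "fold (\<lambda>i s. insert_loop left (arr s i) (i - 1) s)"
  have "sim (\<lambda>x. x) {left..right} a b (?f xs s) (?f xs t)"
    if "set xs \<subseteq> {left+1..right}" for xs
    using that assms
  proof (induction xs arbitrary: s t)
    case (Cons x xs)
    have "arr t x = arr s x" using sim_arr[OF Cons.prems(2), of x] Cons.prems by auto
    then show ?case using Cons.prems by (auto intro!: Cons.IH insert_loop_sim)
  qed auto
  then show ?thesis by (auto simp: insertion_sort_def)
qed

lemma partition_loop_outside:
  assumes "partition_loop p q l k g s = (l', g', s')" "l \<le> k" "i < l \<or> i > g"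
  shows "arr s' i = arr s i"
  using assms
proof (induction p q l k g s rule: partition_loop.induct)
  case (1 p q l k g s)
  show ?case
  proof (cases "k \<le> g")
    case False
    then show ?thesis using "1.prems" by (simp add: partition_loop.simps)
  next
    case True
    define h where "h = scan_down (arr s) q k g"
    have h: "h \<le> g" "k \<le> h"
      using scan_down_le scan_down_ge True by (auto simp: h_def)
    note [simp] = arr_single_swap arr_double_swap Transposition.transpose_def
    consider (a) "arr s k < p" | (b) "\<not> arr s k < p" "arr s k \<ge> q" "arr s h \<ge> p"
      | (c) "\<not> arr s k < p" "arr s k \<ge> q" "\<not> arr s h \<ge> p"
      | (d) "\<not> arr s k < p" "\<not> arr s k \<ge> q"
      by blast
    then show ?thesis
    proof cases
      case a
      then have "partition_loop p q (l + 1) (k + 1) g (single_swap k l s) = (l', g', s')"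
        using "1.prems"(1) True by (subst (asm) partition_loop.simps) auto
      from "1.IH"(1)[OF True a this] show ?thesis using "1.prems" True by auto
    next
      case b
      then have "partition_loop p q l (k + 1) (h - 1) (single_swap k h s) = (l', g', s')"
        using "1.prems"(1) True by (subst (asm) partition_loop.simps) (auto simp: h_def Let_def)
      from "1.IH"(2)[OF True b(1,2) h_def b(3) this] show ?thesis
        using "1.prems" True h by auto
    next
      case c
      then have "partition_loop p q (l + 1) (k + 1) (h - 1) (double_swap k h l s) = (l', g', s')"
        using "1.prems"(1) True by (subst (asm) partition_loop.simps) (auto simp: h_def Let_def)
      from "1.IH"(3)[OF True c(1,2) h_def c(3) this] show ?thesis
        using "1.prems" True h by auto
    next
      case d
      then have "partition_loop p q l (k + 1) g s = (l', g', s')"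
        using "1.prems"(1) True by (subst (asm) partition_loop.simps) auto
      from "1.IH"(4)[OF True d this] show ?thesis using "1.prems" True by auto
    qed
  qed
qed

lemma partition_step_outside:
  assumes "partition_step left right s = (l, g, s')" "left \<le> right" "i \<notin> {left..right}"
  shows "arr s' i = arr s i"
proof -
  obtain l1 g1 s1 where pl:
    "partition_loop (min (arr s left) (arr s right)) (max (arr s left) (arr s right))
       (left + 1) (left + 1) (right - 1) s = (l1, g1, s1)"
    using prod_cases3 by blast
  have "arr s1 i = arr s i"
    using partition_loop_outside[OF pl] assms(3) by auto
  then show ?thesis
    using partition_step_eq[OF pl] assms partition_step_bounds[OF assms(1,2)] by auto
qed

lemma quicksort_outside:
  assumes "i \<notin> {left..right}"
  shows "arr (quicksort M left right s) i = arr s i"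
  using assms
proof (induction M left right s rule: quicksort.induct)
  case (1 M left right s)
  show ?case
  proof (cases "right - left < int M")
    case True
    then show ?thesis using insertion_sort_outside[OF "1.prems"] by (simp add: quicksort.simps)
  next
    case False
    then have lr: "left \<le> right" by auto
    obtain l g s1 where p: "partition_step left right s = (l, g, s1)"
      using prod_cases3 by blast
    note b = partition_step_bounds[OF p lr]
    define s2 where "s2 = quicksort M left (l - 1) s1"
    define s3 where "s3 = quicksort M (l + 1) (g - 1) s2"
    have "quicksort M left right s = quicksort M (g + 1) right s3"
      using False p by (subst quicksort.simps) (auto simp: s2_def s3_def Let_def)
    moreover have "arr (quicksort M (g + 1) right s3) i = arr s3 i"
      using "1.IH"(3)[OF False refl p[symmetric] refl s2_def s3_def] "1.prems" b by auto
    moreover have "arr s3 i = arr s2 i"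
      using "1.IH"(2)[OF False refl p[symmetric] refl s2_def] "1.prems" b by (auto simp: s3_def)
    moreover have "arr s2 i = arr s1 i"
      using "1.IH"(1)[OF False refl p[symmetric] refl] "1.prems" b by (auto simp: s2_def)
    ultimately show ?thesis using partition_step_outside[OF p lr "1.prems"] by simp
  qed
qed

text \<open>This makes the cost added by a call a function of its own segment, whatever the earlier
  calls wrote elsewhere and whatever the counters show. Each recursive call is compared on its own
  segment, and the agreement is then widened to the whole range by
  \<open>sim_extend\<close>.\<close>

lemma quicksort_sim:
  assumes "sim (\<lambda>x. x) {left..right} a b s t"
  shows "sim (\<lambda>x. x) {left..right} a b (quicksort M left right s) (quicksort M left right t)"
  using assms
proof (induction M left right s arbitrary: t rule: quicksort.induct)
  case (1 M left right s)
  show ?case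
  proof (cases "right - left < int M")
    case True
    then show ?thesis using insertion_sort_sim[OF "1.prems"] by (simp add: quicksort.simps)
  next
    case False
    then have lr: "left \<le> right" by auto
    obtain l g s1 where p: "partition_step left right s = (l, g, s1)"
      using prod_cases3 by blast
    from partition_step_sim[OF "1.prems" lr refl _ refl _ _ _ _ p] obtain t1 where
      p': "partition_step left right t = (l, g, t1)" and t1: "sim (\<lambda>x. x) {left..right} a b s1 t1"
      by auto
    note b = partition_step_bounds[OF p lr]
    define s2 where "s2 = quicksort M left (l - 1) s1"
    define s3 where "s3 = quicksort M (l + 1) (g - 1) s2"
    define t2 where "t2 = quicksort M left (l - 1) t1"
    define t3 where "t3 = quicksort M (l + 1) (g - 1) t2"
    have e: "quicksort M left right s = quicksort M (g + 1) right s3"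
      "quicksort M left right t = quicksort M (g + 1) right t3"
      using False p p' by (subst quicksort.simps; auto simp: s2_def s3_def t2_def t3_def Let_def)+
    have "sim (\<lambda>x. x) {left..l-1} a b s2 t2"
      using "1.IH"(1)[OF False refl p[symmetric] refl, of t1] sim_mono[OF t1] b
      by (auto simp: s2_def t2_def)
    from sim_extend[OF this t1] have t2: "sim (\<lambda>x. x) {left..right} a b s2 t2"
      by (simp add: s2_def t2_def quicksort_outside)
    have "sim (\<lambda>x. x) {l+1..g-1} a b s3 t3"
      using "1.IH"(2)[OF False refl p[symmetric] refl s2_def, of t2] sim_mono[OF t2] b
      by (auto simp: s3_def t3_def)
    from sim_extend[OF this t2] have t3: "sim (\<lambda>x. x) {left..right} a b s3 t3"
      by (simp add: s3_def t3_def quicksort_outside)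
    have "sim (\<lambda>x. x) {g+1..right} a b (quicksort M (g + 1) right s3) (quicksort M (g + 1) right t3)"
      using "1.IH"(3)[OF False refl p[symmetric] refl s2_def s3_def, of t3] sim_mono[OF t3] b
      by auto
    from sim_extend[OF this t3] show ?thesis unfolding e
      by (simp add: quicksort_outside)
  qed
qed

subsection \<open>Effect and cost of a partitioning step\<close>

definition cnt :: "(int \<Rightarrow> bool) \<Rightarrow> int \<Rightarrow> int \<Rightarrow> nat" where
  "cnt P a b = card {i \<in> {a..b}. P i}"

lemma cnt_cong: "(\<And>i. a \<le> i \<Longrightarrow> i \<le> b \<Longrightarrow> P i = Q i) \<Longrightarrow> cnt P a b = cnt Q a b"
  unfolding cnt_def by (rule arg_cong[where f = card]) auto

lemma cnt_zero: "(\<And>i. a \<le> i \<Longrightarrow> i \<le> b \<Longrightarrow> \<not> P i) \<Longrightarrow> cnt P a b = 0"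
  unfolding cnt_def by (auto simp: card_eq_0_iff)

lemma cnt_empty [simp]: "b < a \<Longrightarrow> cnt P a b = 0"
  by (rule cnt_zero) auto

lemma cnt_split: "a \<le> c + 1 \<Longrightarrow> c \<le> b \<Longrightarrow> cnt P a b = cnt P a c + cnt P (c + 1) b"
  unfolding cnt_def
  by (subst card_Un_disjoint[symmetric])
    (auto intro!: arg_cong[where f = card] finite_subset[OF _ finite_atLeastAtMost_int])

lemma cnt_single [simp]: "cnt P a a = (if P a then 1 else 0)"
proof -
  have "{i \<in> {a..a}. P i} = (if P a then {a} else {})" by auto
  then show ?thesis by (simp add: cnt_def)
qed

lemma cnt_first: "a \<le> b \<Longrightarrow> cnt P a b = (if P a then 1 else 0) + cnt P (a + 1) b"
  using cnt_split[of a a b P] by simp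

lemma cnt_last: "a \<le> b \<Longrightarrow> cnt P a b = cnt P a (b - 1) + (if P b then 1 else 0)"
  using cnt_split[of a "b - 1" b P] by simp

lemma cnt_shrink:
  "a \<le> c + 1 \<Longrightarrow> c \<le> b \<Longrightarrow> (\<And>i. c < i \<Longrightarrow> i \<le> b \<Longrightarrow> \<not> P i) \<Longrightarrow> cnt P a b = cnt P a c"
  using cnt_split[of a c b P] cnt_zero[of "c + 1" b P] by simp

lemma scan_down_above: "scan_down A q k g < i \<Longrightarrow> i \<le> g \<Longrightarrow> A i > q"
proof (induction A q k g rule: scan_down.induct)
  case (1 A q k g)
  show ?case
  proof (cases "A g > q \<and> k < g")
    case True
    then have "scan_down A q k g = scan_down A q k (g - 1)" by (subst scan_down.simps) simp
    then show ?thesis using 1 True by (cases "i = g") auto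
  next
    case False
    then have "scan_down A q k g = g" by (subst scan_down.simps) auto
    then show ?thesis using 1 by auto
  qed
qed

lemma scan_down_stop: "k \<le> g \<Longrightarrow> scan_down A q k g = k \<or> A (scan_down A q k g) \<le> q"
proof (induction A q k g rule: scan_down.induct)
  case (1 A q k g)
  show ?case
  proof (cases "A g > q \<and> k < g")
    case True
    then have "scan_down A q k g = scan_down A q k (g - 1)" by (subst scan_down.simps) simp
    then show ?thesis using 1 True by auto
  next
    case False
    then have "scan_down A q k g = g" by (subst scan_down.simps) auto
    then show ?thesis using 1 False by auto
  qed
qed

text \<open>The loop invariant: blocks of small, medium, unseen and large entries from left to
  right, where \<open>{k..g}\<close> is the unseen block.\<close>

definition partitioned :: "int \<Rightarrow> int \<Rightarrow> int \<Rightarrow> int \<Rightarrow> int \<Rightarrow> int \<Rightarrow> int \<Rightarrow> (int \<Rightarrow> int) \<Rightarrow> bool" where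
  "partitioned p q lo hi l k g A \<longleftrightarrow> (\<forall>i\<in>{lo..<l}. A i < p) \<and>
     (\<forall>i\<in>{l..<k}. p \<le> A i \<and> A i < q) \<and> (\<forall>i\<in>{g<..hi}. q \<le> A i)"

definition rearranged :: "int set \<Rightarrow> (int \<Rightarrow> int) \<Rightarrow> (int \<Rightarrow> int) \<Rightarrow> bool" where
  "rearranged I A B \<longleftrightarrow> (\<exists>\<pi>. \<pi> permutes I \<and> B = A \<circ> \<pi>)"

lemma rearranged_refl [simp]: "rearranged I A A"
  unfolding rearranged_def by (intro exI[of _ id]) (auto intro: permutes_id)

lemma rearranged_comp: "\<pi> permutes I \<Longrightarrow> rearranged I A (A \<circ> \<pi>)"
  unfolding rearranged_def by blast

lemma rearranged_trans: "rearranged I A B \<Longrightarrow> rearranged I B C \<Longrightarrow> rearranged I A C"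
  unfolding rearranged_def by (metis comp_assoc permutes_compose)

lemma comp_permutes_trans: "\<pi> permutes I \<Longrightarrow> rearranged I (A \<circ> \<pi>) B \<Longrightarrow> rearranged I A B"
  using rearranged_trans rearranged_comp by blast

text \<open>The counts refer to the array before the loop: positions from \<open>k\<close> to \<open>g\<close> are untouched when
  either index reaches them. The index \<open>k\<close> visits the positions up to \<open>g'\<close>, and also \<open>g' + 1\<close> if a
  large element was there.\<close>

lemma partition_loop_result:
  assumes "partition_loop p q l k g s = (l', g', s')" "p < q"
    and "lo \<le> l" "l \<le> k" "k \<le> g + 1" "g \<le> hi"
    and "\<And>i. i \<in> {lo..hi} \<Longrightarrow> arr s i \<noteq> q"
    and "partitioned p q lo hi l k g (arr s)"
  shows "rearranged {lo..hi} (arr s) (arr s') \<and>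
    partitioned p q lo hi l' (g' + 1) g' (arr s') \<and>
    g' = k - 1 + int (cnt (\<lambda>i. arr s i < q) k g) \<and>
    swaps s' = swaps s + cnt (\<lambda>i. arr s i < p) k g + cnt (\<lambda>i. q \<le> arr s i) k (min g (g' + 1)) \<and>
    writes s' + cnt (\<lambda>i. arr s i < p) (g' + 1) g = writes s + 2 * cnt (\<lambda>i. arr s i < p) k g
      + 2 * cnt (\<lambda>i. q \<le> arr s i) k (min g (g' + 1))"
  using assms
proof (induction p q l k g s rule: partition_loop.induct)
  case (1 p q l k g s)
  note pq = \<open>p < q\<close> and bounds = "1.prems"(3-6) and neq = "1.prems"(7)
  have part: "\<And>i. lo \<le> i \<Longrightarrow> i < l \<Longrightarrow> arr s i < p" "\<And>i. l \<le> i \<Longrightarrow> i < k \<Longrightarrow> p \<le> arr s i"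
    "\<And>i. l \<le> i \<Longrightarrow> i < k \<Longrightarrow> arr s i < q" "\<And>i. g < i \<Longrightarrow> i \<le> hi \<Longrightarrow> q \<le> arr s i"
    using "1.prems"(8) by (auto simp: partitioned_def)
  show ?case
  proof (cases "k \<le> g")
    case False
    then have "k = g + 1" "l' = l" "g' = g" "s' = s"
      using "1.prems"(1) bounds by (auto simp: partition_loop.simps)
    then show ?thesis using "1.prems"(8) by simp
  next
    case True
    define h where "h = scan_down (arr s) q k g"
    have h: "h \<le> g" "k \<le> h"
      using scan_down_le scan_down_ge True by (auto simp: h_def)
    have habove: "arr s i > q" if "h < i" "i \<le> g" for i
      using that scan_down_above by (auto simp: h_def)
    \<comment> \<open>No entry in the range equals \<open>q\<close>, so an entry that stops the scan
      before \<open>k\<close> is reached is not large. The swap then brings a small or medium entry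
      to \<open>k\<close>.\<close>
    have hstop: "h = k \<or> arr s h < q"
      using scan_down_stop[OF True, of "arr s" q] neq[of h] h bounds by (auto simp: h_def)
    consider (a) "arr s k < p" | (b) "\<not> arr s k < p" "arr s k \<ge> q" "arr s h \<ge> p"
      | (c) "\<not> arr s k < p" "arr s k \<ge> q" "\<not> arr s h \<ge> p"
      | (d) "\<not> arr s k < p" "\<not> arr s k \<ge> q"
      by blast
    then show ?thesis
    proof cases
      case a
      define s2 where "s2 = single_swap k l s"
      have rec: "partition_loop p q (l + 1) (k + 1) g s2 = (l', g', s')"
        using a "1.prems"(1) True by (subst (asm) partition_loop.simps) (auto simp: s2_def)
      have arr2: "arr s2 = arr s \<circ> Transposition.transpose k l"
        by (simp add: s2_def arr_single_swap)
      have perm: "Transposition.transpose k l permutes {lo..hi}"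
        using bounds True by (intro permutes_swap_id) auto
      have same: "arr s2 i = arr s i" if "k < i" for i
        using that bounds by (simp add: arr2 Transposition.transpose_def)
      have neq2: "arr s2 i \<noteq> q" if "i \<in> {lo..hi}" for i
        using neq[of "Transposition.transpose k l i"] permutes_in_image[OF perm, of i] that
        by (simp add: arr2)
      have "partitioned p q lo hi (l + 1) (k + 1) g (arr s2)"
        using a part bounds True
        by (auto simp: partitioned_def arr2 Transposition.transpose_def)
      from "1.IH"(1)[OF True a, folded s2_def, OF rec pq _ _ _ _ neq2 this] bounds True
      have IH: "rearranged {lo..hi} (arr s2) (arr s')"
        "partitioned p q lo hi l' (g' + 1) g' (arr s')"
        "g' = k + int (cnt (\<lambda>i. arr s2 i < q) (k + 1) g)"
        "swaps s' = swaps s2 + cnt (\<lambda>i. arr s2 i < p) (k + 1) g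
           + cnt (\<lambda>i. q \<le> arr s2 i) (k + 1) (min g (g' + 1))"
        "writes s' + cnt (\<lambda>i. arr s2 i < p) (g' + 1) g = writes s2
           + 2 * cnt (\<lambda>i. arr s2 i < p) (k + 1) g
           + 2 * cnt (\<lambda>i. q \<le> arr s2 i) (k + 1) (min g (g' + 1))"
        by auto
      have "k \<le> g'" using IH(3) by simp
      then have eqs: "cnt (\<lambda>i. arr s2 i < q) (k + 1) g = cnt (\<lambda>i. arr s i < q) (k + 1) g"
        "cnt (\<lambda>i. arr s2 i < p) (k + 1) g = cnt (\<lambda>i. arr s i < p) (k + 1) g"
        "cnt (\<lambda>i. q \<le> arr s2 i) (k + 1) (min g (g' + 1)) = cnt (\<lambda>i. q \<le> arr s i) (k + 1) (min g (g' + 1))"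
        "cnt (\<lambda>i. arr s2 i < p) (g' + 1) g = cnt (\<lambda>i. arr s i < p) (g' + 1) g"
        by (auto intro!: cnt_cong simp: same)
      have "cnt (\<lambda>i. arr s i < q) k g = 1 + cnt (\<lambda>i. arr s i < q) (k + 1) g"
        "cnt (\<lambda>i. arr s i < p) k g = 1 + cnt (\<lambda>i. arr s i < p) (k + 1) g"
        "cnt (\<lambda>i. q \<le> arr s i) k (min g (g' + 1)) = cnt (\<lambda>i. q \<le> arr s i) (k + 1) (min g (g' + 1))"
        using a pq True \<open>k \<le> g'\<close> by (subst cnt_first; simp)+
      then show ?thesis
        using IH(2-) comp_permutes_trans[OF perm IH(1)[unfolded arr2]] unfolding eqs
        by (simp add: s2_def)
    next
      case d
      have rec: "partition_loop p q l (k + 1) g s = (l', g', s')"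
        using d "1.prems"(1) True by (subst (asm) partition_loop.simps) auto
      have "partitioned p q lo hi l (k + 1) g (arr s)"
      proof -
        have "{l..<k + 1} = insert k {l..<k}" using bounds by auto
        then show ?thesis using d part by (auto simp: partitioned_def)
      qed
      from "1.IH"(4)[OF True d rec pq _ _ _ _ neq this] bounds True
      have IH: "rearranged {lo..hi} (arr s) (arr s')"
        "partitioned p q lo hi l' (g' + 1) g' (arr s')"
        "g' = k + int (cnt (\<lambda>i. arr s i < q) (k + 1) g)"
        "swaps s' = swaps s + cnt (\<lambda>i. arr s i < p) (k + 1) g
           + cnt (\<lambda>i. q \<le> arr s i) (k + 1) (min g (g' + 1))"
        "writes s' + cnt (\<lambda>i. arr s i < p) (g' + 1) g = writes s
           + 2 * cnt (\<lambda>i. arr s i < p) (k + 1) g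
           + 2 * cnt (\<lambda>i. q \<le> arr s i) (k + 1) (min g (g' + 1))"
        by auto
      have "k \<le> g'" using IH(3) by simp
      have "cnt (\<lambda>i. arr s i < q) k g = 1 + cnt (\<lambda>i. arr s i < q) (k + 1) g"
        "cnt (\<lambda>i. arr s i < p) k g = cnt (\<lambda>i. arr s i < p) (k + 1) g"
        "cnt (\<lambda>i. q \<le> arr s i) k (min g (g' + 1)) = cnt (\<lambda>i. q \<le> arr s i) (k + 1) (min g (g' + 1))"
        using d pq True \<open>k \<le> g'\<close> by (subst cnt_first; simp)+
      then show ?thesis using IH by simp
    next
      case b
      \<comment> \<open>One swap and two writes pay for the large entry at \<open>k\<close>. If
        \<open>h\<close> differs from \<open>k\<close>, the entry at \<open>h\<close> is medium and
        adds to neither count.\<close>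
      define s2 where "s2 = single_swap k h s"
      have rec: "partition_loop p q l (k + 1) (h - 1) s2 = (l', g', s')"
        using b "1.prems"(1) True
        by (subst (asm) partition_loop.simps) (auto simp: h_def Let_def s2_def)
      have arr2: "arr s2 = arr s \<circ> Transposition.transpose k h"
        by (simp add: s2_def arr_single_swap)
      have perm: "Transposition.transpose k h permutes {lo..hi}"
        using bounds True h by (intro permutes_swap_id) auto
      show ?thesis
      proof (cases "h = k")
        case eq: True
        \<comment> \<open>Everything from \<open>k\<close> to \<open>g\<close> is large. The entry
          at \<open>k\<close> is swapped with itself at full charge, and the loop ends with
          \<open>g' = k - 1\<close>. This is the situation in which \<open>k\<close> has visited the
          position \<open>g' + 1\<close>.\<close>
        have res: "l' = l" "g' = k - 1" "s' = s2"
          using rec eq by (auto simp: partition_loop.simps)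
        have large: "q \<le> arr s i" if "k \<le> i" "i \<le> g" for i
          using habove[of i] that b(2) eq by (cases "i = k") auto
        have large': "q \<le> arr s i" if "k \<le> i" "i \<le> hi" for i
          using large[of i] that part(4)[of i] by force
        have z: "cnt (\<lambda>i. arr s i < q) k g = 0" "cnt (\<lambda>i. arr s i < p) k g = 0"
          using large pq by (intro cnt_zero; force)+
        have "partitioned p q lo hi l (g' + 1) g' (arr s)"
          using part large' by (auto simp: partitioned_def res)
        then show ?thesis using z b(2) True perm
          by (auto simp: res arr_single_swap s2_def eq min_def)
      next
        case neqk: False
        then have hk: "k < h" "arr s h < q" using h hstop by auto
        have same: "arr s2 i = arr s i" if "k < i" "i < h" for i
          using that bounds by (simp add: arr2 Transposition.transpose_def)
        have neq2: "arr s2 i \<noteq> q" if "i \<in> {lo..hi}" for i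
          using neq[of "Transposition.transpose k h i"] permutes_in_image[OF perm, of i] that
          by (simp add: arr2)
        have "partitioned p q lo hi l (k + 1) (h - 1) (arr s2)"
          unfolding partitioned_def arr2
        proof (intro conjI ballI, goal_cases)
          case (1 i)
          then show ?case using part(1) bounds hk by (auto simp: Transposition.transpose_def)
        next
          case (2 i)
          then show ?case using part(2)[of i] part(2)[of l] b bounds hk pq
            by (cases "i = k") (auto simp: Transposition.transpose_def)
        next
          case (3 i)
          then show ?case using part(3)[of i] part(3)[of l] b bounds hk pq
            by (cases "i = k") (auto simp: Transposition.transpose_def)
        next
          case (4 i)
          then consider "i = h" | "h < i" "i \<le> g" | "g < i" "i \<le> hi" by fastforce
          then show ?case
            using part(4)[of i] habove[of i] b bounds hk h
            by cases (auto simp: Transposition.transpose_def)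
        qed
        from "1.IH"(2)[OF True b(1,2) h_def b(3), folded s2_def, OF rec pq _ _ _ _ neq2 this] bounds True hk h
        have IH: "rearranged {lo..hi} (arr s2) (arr s')"
          "partitioned p q lo hi l' (g' + 1) g' (arr s')"
          "g' = k + int (cnt (\<lambda>i. arr s2 i < q) (k + 1) (h - 1))"
          "swaps s' = swaps s2 + cnt (\<lambda>i. arr s2 i < p) (k + 1) (h - 1)
             + cnt (\<lambda>i. q \<le> arr s2 i) (k + 1) (min (h - 1) (g' + 1))"
          "writes s' + cnt (\<lambda>i. arr s2 i < p) (g' + 1) (h - 1) = writes s2
             + 2 * cnt (\<lambda>i. arr s2 i < p) (k + 1) (h - 1)
             + 2 * cnt (\<lambda>i. q \<le> arr s2 i) (k + 1) (min (h - 1) (g' + 1))"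
          by auto
        have g': "k \<le> g'" "g' \<le> h - 1"
          using IH(3) partition_loop_bounds[OF rec] bounds hk by auto
        then have eqs: "cnt (\<lambda>i. arr s2 i < q) (k + 1) (h - 1) = cnt (\<lambda>i. arr s i < q) (k + 1) (h - 1)"
          "cnt (\<lambda>i. arr s2 i < p) (k + 1) (h - 1) = cnt (\<lambda>i. arr s i < p) (k + 1) (h - 1)"
          "cnt (\<lambda>i. q \<le> arr s2 i) (k + 1) (min (h - 1) (g' + 1)) = cnt (\<lambda>i. q \<le> arr s i) (k + 1) (min (h - 1) (g' + 1))"
          "cnt (\<lambda>i. arr s2 i < p) (g' + 1) (h - 1) = cnt (\<lambda>i. arr s i < p) (g' + 1) (h - 1)"
          by (auto intro!: cnt_cong simp: same)
        have outer: "cnt P k g = (if P k then 1 else 0) + cnt P (k + 1) (h - 1) + (if P h then 1 else 0)"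
          if "\<And>i. h < i \<Longrightarrow> i \<le> g \<Longrightarrow> \<not> P i" for P
          using cnt_shrink[of k h g P] cnt_first[of k h P] cnt_last[of "k + 1" h P] h hk that by simp
        have "cnt (\<lambda>i. arr s i < q) k g = 1 + cnt (\<lambda>i. arr s i < q) (k + 1) (h - 1)"
          "cnt (\<lambda>i. arr s i < p) k g = cnt (\<lambda>i. arr s i < p) (k + 1) (h - 1)"
          proof -
            show "cnt (\<lambda>i. arr s i < q) k g = 1 + cnt (\<lambda>i. arr s i < q) (k + 1) (h - 1)"
              using b hk pq outer[of "\<lambda>i. arr s i < q"] less_imp_le[OF habove] by (simp add: not_less)
            show "cnt (\<lambda>i. arr s i < p) k g = cnt (\<lambda>i. arr s i < p) (k + 1) (h - 1)"
              using b hk pq outer[of "\<lambda>i. arr s i < p"] order_trans[OF less_imp_le[OF pq] less_imp_le[OF habove]]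
              by (simp add: not_less)
          qed
        moreover have "cnt (\<lambda>i. arr s i < p) (g' + 1) g = cnt (\<lambda>i. arr s i < p) (g' + 1) (h - 1)"
          proof (intro cnt_shrink)
            fix i assume "h - 1 < i" "i \<le> g"
            then show "\<not> arr s i < p" using b habove[of i] pq by (cases "i = h") auto
          qed (use g' h in auto)
        moreover have "cnt (\<lambda>i. q \<le> arr s i) k (min g (g' + 1))
            = 1 + cnt (\<lambda>i. q \<le> arr s i) (k + 1) (min (h - 1) (g' + 1))"
        proof -
          have "cnt (\<lambda>i. q \<le> arr s i) k (min g (g' + 1)) = 1 + cnt (\<lambda>i. q \<le> arr s i) (k + 1) (g' + 1)"
            using b hk h g' by (subst cnt_first) (auto simp: min_absorb2)
          also have "cnt (\<lambda>i. q \<le> arr s i) (k + 1) (g' + 1) = cnt (\<lambda>i. q \<le> arr s i) (k + 1) (min (h - 1) (g' + 1))"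
            proof (intro cnt_shrink)
            fix i assume "min (h - 1) (g' + 1) < i" "i \<le> g' + 1"
            then have "i = h" using g' by auto
            then show "\<not> q \<le> arr s i" using hk by simp
          qed (use g' in auto)
          finally show ?thesis .
        qed
        ultimately show ?thesis
          using IH(2-) comp_permutes_trans[OF perm IH(1)[unfolded arr2]] unfolding eqs
          by (simp add: s2_def)
      qed
    next
      case c
      \<comment> \<open>Two swaps pay for two entries, the large one at \<open>k\<close> and the
        small one at \<open>h\<close>. The write saved, three instead of four, is recorded by the
        small entry at \<open>h\<close>, which lies beyond \<open>g'\<close>.\<close>
      define s2 where "s2 = double_swap k h l s"
      have rec: "partition_loop p q (l + 1) (k + 1) (h - 1) s2 = (l', g', s')"
        using c "1.prems"(1) True
        by (subst (asm) partition_loop.simps) (auto simp: h_def Let_def s2_def)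
      have hk: "k < h" "arr s h < q" "arr s h < p" using h hstop c by (auto simp: le_less)
      let ?\<pi> = "Transposition.transpose k h \<circ> Transposition.transpose k l"
      have arr2: "arr s2 = arr s \<circ> ?\<pi>"
        by (simp add: s2_def arr_double_swap comp_assoc)
      have perm: "?\<pi> permutes {lo..hi}"
        using bounds True h by (intro permutes_compose permutes_swap_id) auto
      have same: "arr s2 i = arr s i" if "k < i" "i < h" for i
        using that bounds by (simp add: arr2 Transposition.transpose_def)
      have neq2: "arr s2 i \<noteq> q" if "i \<in> {lo..hi}" for i
        using neq[of "?\<pi> i"] permutes_in_image[OF perm, of i] that
        by (simp add: arr2)
      have "partitioned p q lo hi (l + 1) (k + 1) (h - 1) (arr s2)"
          unfolding partitioned_def arr2
        proof (intro conjI ballI, goal_cases)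
          case (1 i)
          then show ?case using part(1) bounds hk c by (auto simp: Transposition.transpose_def)
        next
          case (2 i)
          then show ?case using part(2)[of i] part(2)[of l] c bounds hk pq
            by (cases "i = k") (auto simp: Transposition.transpose_def)
        next
          case (3 i)
          then show ?case using part(3)[of i] part(3)[of l] c bounds hk pq
            by (cases "i = k") (auto simp: Transposition.transpose_def)
        next
          case (4 i)
          then consider "i = h" | "h < i" "i \<le> g" | "g < i" "i \<le> hi" by fastforce
          then show ?case
            using part(4)[of i] habove[of i] c bounds hk h
            by cases (auto simp: Transposition.transpose_def)
        qed
      from "1.IH"(3)[OF True c(1,2) h_def c(3), folded s2_def, OF rec pq _ _ _ _ neq2 this] bounds True hk h
      have IH: "rearranged {lo..hi} (arr s2) (arr s')"
        "partitioned p q lo hi l' (g' + 1) g' (arr s')"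
        "g' = k + int (cnt (\<lambda>i. arr s2 i < q) (k + 1) (h - 1))"
        "swaps s' = swaps s2 + cnt (\<lambda>i. arr s2 i < p) (k + 1) (h - 1)
           + cnt (\<lambda>i. q \<le> arr s2 i) (k + 1) (min (h - 1) (g' + 1))"
        "writes s' + cnt (\<lambda>i. arr s2 i < p) (g' + 1) (h - 1) = writes s2
           + 2 * cnt (\<lambda>i. arr s2 i < p) (k + 1) (h - 1)
           + 2 * cnt (\<lambda>i. q \<le> arr s2 i) (k + 1) (min (h - 1) (g' + 1))"
        by auto
      have g': "k \<le> g'" "g' \<le> h - 1"
        using IH(3) partition_loop_bounds[OF rec] bounds hk by auto
      then have eqs: "cnt (\<lambda>i. arr s2 i < q) (k + 1) (h - 1) = cnt (\<lambda>i. arr s i < q) (k + 1) (h - 1)"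
        "cnt (\<lambda>i. arr s2 i < p) (k + 1) (h - 1) = cnt (\<lambda>i. arr s i < p) (k + 1) (h - 1)"
        "cnt (\<lambda>i. q \<le> arr s2 i) (k + 1) (min (h - 1) (g' + 1)) = cnt (\<lambda>i. q \<le> arr s i) (k + 1) (min (h - 1) (g' + 1))"
        "cnt (\<lambda>i. arr s2 i < p) (g' + 1) (h - 1) = cnt (\<lambda>i. arr s i < p) (g' + 1) (h - 1)"
        by (auto intro!: cnt_cong simp: same)
      have outer: "cnt P k g = (if P k then 1 else 0) + cnt P (k + 1) (h - 1) + (if P h then 1 else 0)"
        if "\<And>i. h < i \<Longrightarrow> i \<le> g \<Longrightarrow> \<not> P i" for P
        using cnt_shrink[of k h g P] cnt_first[of k h P] cnt_last[of "k + 1" h P] h hk that by simp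
      have "cnt (\<lambda>i. arr s i < q) k g = 1 + cnt (\<lambda>i. arr s i < q) (k + 1) (h - 1)"
        "cnt (\<lambda>i. arr s i < p) k g = 1 + cnt (\<lambda>i. arr s i < p) (k + 1) (h - 1)"
        proof -
          show "cnt (\<lambda>i. arr s i < q) k g = 1 + cnt (\<lambda>i. arr s i < q) (k + 1) (h - 1)"
            using c hk pq outer[of "\<lambda>i. arr s i < q"] less_imp_le[OF habove] by (simp add: not_less)
          show "cnt (\<lambda>i. arr s i < p) k g = 1 + cnt (\<lambda>i. arr s i < p) (k + 1) (h - 1)"
            using c hk pq outer[of "\<lambda>i. arr s i < p"] order_trans[OF less_imp_le[OF pq] less_imp_le[OF habove]]
            by (simp add: not_less)
        qed
      moreover have "cnt (\<lambda>i. arr s i < p) (g' + 1) g = 1 + cnt (\<lambda>i. arr s i < p) (g' + 1) (h - 1)"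
      proof -
        have "cnt (\<lambda>i. arr s i < p) (g' + 1) g = cnt (\<lambda>i. arr s i < p) (g' + 1) h"
          proof (intro cnt_shrink)
            fix i assume "h < i" "i \<le> g"
            then show "\<not> arr s i < p" using habove[of i] pq by auto
          qed (use g' h in auto)
        then show ?thesis using hk g' by (subst (asm) (2) cnt_last) auto
      qed
      moreover have "cnt (\<lambda>i. q \<le> arr s i) k (min g (g' + 1))
          = 1 + cnt (\<lambda>i. q \<le> arr s i) (k + 1) (min (h - 1) (g' + 1))"
      proof -
        have "cnt (\<lambda>i. q \<le> arr s i) k (min g (g' + 1)) = 1 + cnt (\<lambda>i. q \<le> arr s i) (k + 1) (g' + 1)"
          using c hk h g' by (subst cnt_first) (auto simp: min_absorb2)
        also have "cnt (\<lambda>i. q \<le> arr s i) (k + 1) (g' + 1) = cnt (\<lambda>i. q \<le> arr s i) (k + 1) (min (h - 1) (g' + 1))"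
          proof (intro cnt_shrink)
            fix i assume "min (h - 1) (g' + 1) < i" "i \<le> g' + 1"
            then have "i = h" using g' by auto
            then show "\<not> q \<le> arr s i" using hk by simp
          qed (use g' in auto)
        finally show ?thesis .
      qed
      ultimately show ?thesis
        using IH(2-) comp_permutes_trans[OF perm IH(1)[unfolded arr2]] unfolding eqs
        by (simp add: s2_def)
    qed
  qed
qed

section \<open>A complete partitioning step, including the placement of the pivots\<close>

lemma rearranged_mono: "rearranged I A B \<Longrightarrow> I \<subseteq> J \<Longrightarrow> rearranged J A B"
  unfolding rearranged_def using permutes_subset by blast

lemma rearranged_image: "rearranged I A B \<Longrightarrow> B ` I = A ` I"
  unfolding rearranged_def by (metis image_comp permutes_image)

lemma rearranged_inj_on: "rearranged I A B \<Longrightarrow> inj_on A I \<Longrightarrow> inj_on B I"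
  unfolding rearranged_def
  by (metis comp_inj_on_iff permutes_image permutes_inj_on)

lemma rearranged_outside: "rearranged I A B \<Longrightarrow> i \<notin> I \<Longrightarrow> B i = A i"
  unfolding rearranged_def by (auto simp: permutes_def)

lemma partition_step_result:
  assumes lr: "left < right" and inj: "inj_on (arr s) {left..right}"
    and step: "partition_step left right s = (l, g, s')"
    and p_def: "p = min (arr s left) (arr s right)" and q_def: "q = max (arr s left) (arr s right)"
  shows "rearranged {left..right} (arr s) (arr s')" "left \<le> l" "l < g" "g \<le> right"
    "arr s' l = p" "arr s' g = q"
    "\<And>i. i \<in> {left..<l} \<Longrightarrow> arr s' i < p"
    "\<And>i. i \<in> {l<..<g} \<Longrightarrow> p < arr s' i \<and> arr s' i < q"
    "\<And>i. i \<in> {g<..right} \<Longrightarrow> q < arr s' i"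
    "swaps s' = swaps s + 2 + cnt (\<lambda>i. arr s i < p) (left + 1) (right - 1)
       + cnt (\<lambda>i. q < arr s i) (left + 1) (min (right - 1) g)"
    "writes s' + cnt (\<lambda>i. arr s i < p) g (right - 1) = writes s + 4
       + 2 * cnt (\<lambda>i. arr s i < p) (left + 1) (right - 1)
       + 2 * cnt (\<lambda>i. q < arr s i) (left + 1) (min (right - 1) g)"
proof -
  have neq: "arr s left \<noteq> arr s right"
    using inj_onD[OF inj, of left right] lr by auto
  then have pq: "p < q" by (auto simp: p_def q_def)
  have mid: "arr s i \<noteq> p \<and> arr s i \<noteq> q" if "i \<in> {left+1..right-1}" for i
    using inj_onD[OF inj, of i left] inj_onD[OF inj, of i right] that lr
    by (auto simp: p_def q_def min_def max_def)
  obtain l1 g1 s1 where pl: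
    "partition_loop p q (left + 1) (left + 1) (right - 1) s = (l1, g1, s1)"
    using prod_cases3 by blast
  note step' = partition_step_eq[of s left right, folded p_def q_def, OF pl]
  have l: "l1 = l + 1" and g: "g1 = g - 1" using step step' by auto
  have s': "s' = charge 2 0 (put g q (put right (arr (put l p (put left (arr s1 l) s1)) g)
      (put l p (put left (arr s1 l) s1))))"
    using step step' l g by auto
  note res = partition_loop_result[OF pl pq _ _ _ order_refl, of "left + 1"]
  have R: "rearranged {left+1..right-1} (arr s) (arr s1)"
    "partitioned p q (left+1) (right-1) l1 (g1+1) g1 (arr s1)"
    "g1 = left + int (cnt (\<lambda>i. arr s i < q) (left+1) (right-1))"
    "swaps s1 = swaps s + cnt (\<lambda>i. arr s i < p) (left+1) (right-1)
       + cnt (\<lambda>i. q \<le> arr s i) (left+1) (min (right-1) (g1 + 1))"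
    "writes s1 + cnt (\<lambda>i. arr s i < p) (g1+1) (right-1) = writes s
       + 2 * cnt (\<lambda>i. arr s i < p) (left+1) (right-1)
       + 2 * cnt (\<lambda>i. q \<le> arr s i) (left+1) (min (right-1) (g1 + 1))"
    using res mid lr by (auto simp: partitioned_def)
  have part: "\<And>i. left < i \<Longrightarrow> i \<le> l \<Longrightarrow> arr s1 i < p"
    "\<And>i. l < i \<Longrightarrow> i < g \<Longrightarrow> p \<le> arr s1 i" "\<And>i. l < i \<Longrightarrow> i < g \<Longrightarrow> arr s1 i < q"
    "\<And>i. g \<le> i \<Longrightarrow> i < right \<Longrightarrow> q \<le> arr s1 i"
    using R(2) by (auto simp: partitioned_def l g)
  show b: "left \<le> l" "g \<le> right"
    using partition_loop_bounds[OF pl] lr l g by auto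
  \<comment> \<open>Otherwise position \<open>g\<close> would lie in the small block and in the
    large block at once.\<close>
  show lg: "l < g"
  proof (rule ccontr)
    assume "\<not> l < g"
    moreover have "left < g" using R(3) g by auto
    moreover have "l \<le> right - 1" using partition_loop_bounds[OF pl] lr l by auto
    ultimately show False using part(1)[of g] part(4)[of g] pq by auto
  qed
  have mid1: "arr s1 i \<noteq> p \<and> arr s1 i \<noteq> q" if "i \<in> {left+1..right-1}" for i
  proof -
    have "arr s1 i \<in> arr s ` {left+1..right-1}"
      using rearranged_image[OF R(1)] that by blast
    then obtain j where "arr s1 i = arr s j" "j \<in> {left+1..right-1}" by blast
    then show ?thesis using mid[of j] by metis
  qed
  have ends: "arr s1 left = arr s left" "arr s1 right = arr s right"
    using rearranged_outside[OF R(1)] by auto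
  have arr': "arr s' = (arr s1)(left := arr s1 l, l := p, right := ((arr s1)(left := arr s1 l, l := p)) g, g := q)"
    by (simp add: s')
  show "arr s' l = p" "arr s' g = q" using lg b by (auto simp: arr')
  show "arr s' i < p" if "i \<in> {left..<l}" for i
    using that part(1)[of i] part(1)[of l] lg b by (auto simp: arr')
  show "p < arr s' i \<and> arr s' i < q" if "i \<in> {l<..<g}" for i
    using that part(2,3)[of i] mid1[of i] lg b by (auto simp: arr')
  show "q < arr s' i" if "i \<in> {g<..right}" for i
    using that part(4)[of i] part(4)[of g] mid1[of i] mid1[of g] lg b by (auto simp: arr' less_le)
  have large: "cnt (\<lambda>i. q \<le> arr s i) (left+1) (min (right-1) g)
      = cnt (\<lambda>i. q < arr s i) (left+1) (min (right-1) g)"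
    using mid by (intro cnt_cong) (auto simp: less_le)
  show "swaps s' = swaps s + 2 + cnt (\<lambda>i. arr s i < p) (left + 1) (right - 1)
       + cnt (\<lambda>i. q < arr s i) (left + 1) (min (right - 1) g)"
    using R(4) by (simp add: s' g large)
  show "writes s' + cnt (\<lambda>i. arr s i < p) g (right - 1) = writes s + 4
       + 2 * cnt (\<lambda>i. arr s i < p) (left + 1) (right - 1)
       + 2 * cnt (\<lambda>i. q < arr s i) (left + 1) (min (right - 1) g)"
    using R(5) by (simp add: s' g large)
  \<comment> \<open>The four pivot writes amount to exchanging \<open>left\<close> with
    \<open>l\<close> and \<open>right\<close> with \<open>g\<close>, provided that \<open>p\<close>
    stands at \<open>left\<close> and \<open>q\<close> at \<open>right\<close>. The algorithm only
    chooses the values \<open>p\<close> and \<open>q\<close> and does not order the two ends in the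
    array, so \<open>\<rho>\<close> supplies that exchange when it is needed.\<close>
  define \<rho> where "\<rho> = (if arr s left \<le> arr s right then id else Transposition.transpose left right)"
  define \<sigma> where "\<sigma> = \<rho> \<circ> Transposition.transpose left l \<circ> Transposition.transpose right g"
  have "\<sigma> permutes {left..right}" unfolding \<sigma>_def \<rho>_def
    using lr lg b by (auto intro!: permutes_compose permutes_swap_id permutes_id)
  moreover have "arr s' = arr s1 \<circ> \<sigma>"
    unfolding arr' \<sigma>_def \<rho>_def using lr lg b ends
    by (auto simp: fun_eq_iff Transposition.transpose_def p_def q_def min_def max_def)
  ultimately show "rearranged {left..right} (arr s) (arr s')"
    using rearranged_trans[OF rearranged_mono[OF R(1)] rearranged_comp] by auto
qed

subsection \<open>Insertionsort\<close>

lemma cnt_rearranged: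
  assumes "rearranged {a..b} A B"
  shows "cnt (\<lambda>i. P (B i)) a b = cnt (\<lambda>i. P (A i)) a b"
proof -
  obtain \<pi> where \<pi>: "\<pi> permutes {a..b}" "B = A \<circ> \<pi>"
    using assms by (auto simp: rearranged_def)
  have "{i \<in> {a..b}. P (A i)} = \<pi> ` {i \<in> {a..b}. P (B i)}"
  proof (intro equalityI subsetI)
    fix i assume i: "i \<in> {i \<in> {a..b}. P (A i)}"
    then have "inv \<pi> i \<in> {i \<in> {a..b}. P (B i)}" "i = \<pi> (inv \<pi> i)"
      using \<pi> permutes_in_image[OF permutes_inv[OF \<pi>(1)], of i] permutes_inverses[OF \<pi>(1)]
      by auto
    then show "i \<in> \<pi> ` {i \<in> {a..b}. P (B i)}" by blast
  next
    fix i assume "i \<in> \<pi> ` {i \<in> {a..b}. P (B i)}"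
    then show "i \<in> {i \<in> {a..b}. P (A i)}"
      using permutes_in_image[OF \<pi>(1)] by (auto simp: \<pi>(2))
  qed
  then show ?thesis unfolding cnt_def
    by (simp add: card_image inj_on_subset[OF permutes_inj[OF \<pi>(1)]])
qed

text \<open>Position \<open>j + 1\<close> is a hole that is regarded as holding \<open>v\<close>.
  Moving \<open>A[j]\<close> into the hole is then a transposition of \<open>j\<close> and
  \<open>j + 1\<close>, so the loop rearranges the array \<open>(arr s)(j + 1 := v)\<close>. Because
  the prefix is sorted, the entries passed are exactly those greater than \<open>v\<close>.\<close>

lemma insert_loop_result:
  assumes "left \<le> j + 1" "\<And>x y. left \<le> x \<Longrightarrow> x \<le> y \<Longrightarrow> y \<le> j \<Longrightarrow> arr s x \<le> arr s y"
  shows "rearranged {left..j+1} ((arr s)(j + 1 := v)) (arr (insert_loop left v j s)) \<and>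
    (\<forall>x y. left \<le> x \<longrightarrow> x \<le> y \<longrightarrow> y \<le> j + 1 \<longrightarrow>
       arr (insert_loop left v j s) x \<le> arr (insert_loop left v j s) y) \<and>
    swaps (insert_loop left v j s) = swaps s \<and>
    writes (insert_loop left v j s) = writes s + 1 + cnt (\<lambda>x. v < arr s x) left j"
  using assms
proof (induction left v j s rule: insert_loop.induct)
  case (1 left v j s)
  show ?case
  proof (cases "j \<ge> left \<and> v < arr s j")
    case True
    define s2 where "s2 = put (j + 1) (arr s j) s"
    define s' where "s' = insert_loop left v (j - 1) s2"
    have e: "insert_loop left v j s = s'"
      using True by (subst insert_loop.simps) (simp add: s'_def s2_def)
    have arr2: "arr s2 = (arr s)(j + 1 := arr s j)" by (simp add: s2_def)
    have "arr s2 x \<le> arr s2 y" if "left \<le> x" "x \<le> y" "y \<le> j - 1" for x y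
      using "1.prems"(2)[of x y] that by (simp add: arr2)
    note IH0 = "1.IH"[OF True, folded s2_def s'_def, OF _ this]
    have cost2: "swaps s2 = swaps s" "writes s2 = writes s + 1" by (simp_all add: s2_def)
    have IH: "rearranged {left..j} ((arr s2)(j := v)) (arr s')"
      "\<And>x y. left \<le> x \<Longrightarrow> x \<le> y \<Longrightarrow> y \<le> j \<Longrightarrow> arr s' x \<le> arr s' y"
      "swaps s' = swaps s" "writes s' = writes s + 2 + cnt (\<lambda>x. v < arr s2 x) left (j - 1)"
      using IH0 True by (simp_all add: cost2 fun_upd_def)
    have tr: "(arr s2)(j := v) = (arr s)(j + 1 := v) \<circ> Transposition.transpose j (j + 1)"
      by (auto simp: fun_eq_iff arr2 Transposition.transpose_def)
    have "rearranged {left..j+1} ((arr s)(j + 1 := v)) (arr s')"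
      using rearranged_trans[OF rearranged_comp rearranged_mono[OF IH(1)[unfolded tr]]] True
        permutes_swap_id[of j "{left..j+1}" "j + 1"] by auto
    moreover have "arr s' x \<le> arr s' y" if "left \<le> x" "x \<le> y" "y \<le> j + 1" for x y
    proof (cases "y \<le> j")
      case False
      have y: "arr s' y = arr s j"
        using rearranged_outside[OF IH(1), of y] that False by (auto simp: arr2)
      show ?thesis
      proof (cases "x \<le> j")
        case True
        then have "arr s' x \<in> (arr s2)(j := v) ` {left..j}"
          using rearranged_image[OF IH(1)] that by auto
        then show ?thesis using \<open>j \<ge> left \<and> v < arr s j\<close> "1.prems"(2) unfolding y
          by (auto simp: arr2 image_iff split: if_splits)
      next
        case False
        then have "x = y" using that by simp
        then show ?thesis by simp
      qed
    qed (use IH(2) that in auto)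
    moreover have "cnt (\<lambda>x. v < arr s x) left j = 1 + cnt (\<lambda>x. v < arr s2 x) left (j - 1)"
    proof -
      have "cnt (\<lambda>x. v < arr s2 x) left (j - 1) = cnt (\<lambda>x. v < arr s x) left (j - 1)"
        by (rule cnt_cong) (auto simp: arr2)
      then show ?thesis using True by (subst cnt_last) auto
    qed
    ultimately show ?thesis using IH(3,4) by (simp add: e fun_upd_def)
  next
    case False
    then have e: "insert_loop left v j s = put (j + 1) v s"
      by (subst insert_loop.simps) auto
    have le: "arr s x \<le> v" if "left \<le> x" "x \<le> j" for x
      using False that "1.prems"(2)[of x j] by auto
    have "cnt (\<lambda>x. v < arr s x) left j = 0"
      using le by (intro cnt_zero) (auto simp: not_less)
    then show ?thesis using "1.prems" le by (auto simp: e)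
  qed
qed

text \<open>When position \<open>i\<close> is reached, its entry is still the original one and the
  prefix is a rearrangement of the original prefix. The number of larger entries before it can thus
  be read off the input, and the writes are the inversions of the input plus one final write per
  inserted entry.\<close>

lemma insertion_sort_result:
  assumes "left \<le> right + 1"
  shows "rearranged {left..right} (arr s) (arr (insertion_sort left right s)) \<and>
    (\<forall>x y. left \<le> x \<longrightarrow> x \<le> y \<longrightarrow> y \<le> right \<longrightarrow>
       arr (insertion_sort left right s) x \<le> arr (insertion_sort left right s) y) \<and>
    swaps (insertion_sort left right s) = swaps s \<and>
    writes (insertion_sort left right s) = writes s
      + (\<Sum>i\<in>{left+1..right}. 1 + cnt (\<lambda>j. arr s i < arr s j) left (i - 1))"
proof (cases "right < left")
  case True
  then have "[left + 1..right] = []" by auto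
  then show ?thesis using True by (auto simp: insertion_sort_def)
next
  case False
  then have "left \<le> right" by simp
  then show ?thesis
  proof (induction right rule: int_ge_induct)
    case base
    have "[left + 1..left] = []" by auto
    moreover have "arr s x \<le> arr s y" if "left \<le> x" "x \<le> y" "y \<le> left" for x y
      using that by (metis order_antisym order_refl order_trans)
    ultimately show ?case by (auto simp: insertion_sort_def)
  next
    case (step r)
    define s1 where "s1 = insertion_sort left r s"
    note IH = step.IH[folded s1_def]
    have "[left + 1..r + 1] = [left + 1..r] @ [r + 1]"
      using step.hyps upto_rec2[of "left + 1" "r + 1"] by simp
    then have e: "insertion_sort left (r + 1) s = insert_loop left (arr s1 (r + 1)) r s1"
      by (simp add: insertion_sort_def s1_def)
    have last: "arr s1 (r + 1) = arr s (r + 1)"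
      by (simp add: s1_def insertion_sort_outside)
    have "(arr s1)(r + 1 := arr s1 (r + 1)) = arr s1" by auto
    then have res: "rearranged {left..r+1} (arr s1) (arr (insertion_sort left (r + 1) s))"
      "\<forall>x y. left \<le> x \<longrightarrow> x \<le> y \<longrightarrow> y \<le> r + 1 \<longrightarrow>
       arr (insertion_sort left (r + 1) s) x \<le> arr (insertion_sort left (r + 1) s) y"
      "swaps (insertion_sort left (r + 1) s) = swaps s1"
      "writes (insertion_sort left (r + 1) s) = writes s1 + 1 + cnt (\<lambda>x. arr s (r + 1) < arr s1 x) left r"
      using insert_loop_result[of left r s1 "arr s1 (r + 1)"] IH step.hyps
      by (simp_all add: e last)
    have "cnt (\<lambda>x. arr s (r + 1) < arr s1 x) left r = cnt (\<lambda>x. arr s (r + 1) < arr s x) left r"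
      using IH by (intro cnt_rearranged[where P = "\<lambda>z. arr s (r + 1) < z"]) auto
    moreover have "{left+1..r+1} = insert (r + 1) {left+1..r}" using step.hyps by auto
    moreover have "rearranged {left..r+1} (arr s) (arr (insertion_sort left (r + 1) s))"
      using rearranged_trans[OF rearranged_mono res(1)] IH by auto
    ultimately show ?case using res IH by simp
  qed
qed

subsection \<open>Sums over permutations\<close>

lemma sum_permutes_one:
  fixes h :: "'a \<Rightarrow> real"
  assumes "finite X" "x \<in> X"
  shows "(\<Sum>\<tau> | \<tau> permutes X. h (\<tau> x)) = fact (card X - 1) * (\<Sum>b\<in>X. h b)"
proof -
  define S where "S = X - {x}"
  have X: "X = insert x S" "x \<notin> S" "finite S" using assms by (auto simp: S_def)
  have "h ((Transposition.transpose x b \<circ> q) x) = h b" if "q permutes S" for q b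
    using permutes_not_in[OF that X(2)] by simp
  then have "(\<Sum>\<tau> | \<tau> permutes X. h (\<tau> x)) = (\<Sum>b\<in>X. \<Sum>q | q permutes S. h b)"
    unfolding X(1) by (subst sum_over_permutations_insert[OF X(3,2)]) auto
  also have "\<dots> = (\<Sum>b\<in>X. fact (card X - 1) * h b)"
    using X by (simp add: card_permutations)
  finally show ?thesis by (simp add: sum_distrib_left)
qed

lemma sum_permutes_two:
  fixes h :: "'a \<Rightarrow> 'a \<Rightarrow> real"
  assumes "finite X" "x \<in> X" "y \<in> X" "x \<noteq> y"
  shows "(\<Sum>\<tau> | \<tau> permutes X. h (\<tau> x) (\<tau> y)) = fact (card X - 2) * (\<Sum>a\<in>X. \<Sum>b\<in>X - {a}. h a b)"
proof -
  define S where "S = X - {x}"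
  have X: "X = insert x S" "x \<notin> S" "finite S" "y \<in> S" using assms by (auto simp: S_def)
  have "h ((Transposition.transpose x a \<circ> q) x) ((Transposition.transpose x a \<circ> q) y)
      = h a (Transposition.transpose x a (q y))" if "q permutes S" for q a
    using permutes_not_in[OF that X(2)] by simp
  then have "(\<Sum>\<tau> | \<tau> permutes X. h (\<tau> x) (\<tau> y))
      = (\<Sum>a\<in>X. \<Sum>q | q permutes S. h a (Transposition.transpose x a (q y)))"
    unfolding X(1) by (subst sum_over_permutations_insert[OF X(3,2)]) auto
  also have "\<dots> = (\<Sum>a\<in>X. fact (card X - 2) * (\<Sum>b\<in>S. h a (Transposition.transpose x a b)))"
    using X sum_permutes_one[OF X(3,4)]
    by (intro sum.cong refl) (simp add: card_insert_if)
  also have "\<dots> = (\<Sum>a\<in>X. fact (card X - 2) * (\<Sum>b\<in>X - {a}. h a b))"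
  proof -
    have "(\<Sum>b\<in>S. h a (Transposition.transpose x a b)) = (\<Sum>b\<in>X - {a}. h a b)" if "a \<in> X" for a
    proof (rule sum.reindex_bij_betw)
      show "bij_betw (Transposition.transpose x a) S (X - {a})"
        using assms that unfolding S_def
        by (intro bij_betw_byWitness[where f' = "Transposition.transpose x a"])
          (auto simp: Transposition.transpose_def)
    qed
    then show ?thesis by simp
  qed
  finally show ?thesis by (simp add: sum_distrib_left)
qed

text \<open>Group the permutations by the value of \<open>Y\<close>. On the group belonging to a set
  Z, left composition with a fixed permutation of Z is a bijection, so averaging over all of them
  leaves the sum over the group unchanged. This replaces conditioning on the set of values that
  reaches a subarray.\<close>

lemma sum_permutes_average:
  fixes F :: "('a \<Rightarrow> 'a) \<Rightarrow> real"
  assumes "finite X" and sub: "\<And>\<tau>. \<tau> permutes X \<Longrightarrow> Y \<tau> \<subseteq> X"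
    and inv: "\<And>\<tau> \<sigma>. \<tau> permutes X \<Longrightarrow> \<sigma> permutes Y \<tau> \<Longrightarrow> Y (\<sigma> \<circ> \<tau>) = Y \<tau>"
  shows "(\<Sum>\<tau> | \<tau> permutes X. F \<tau>) =
    (\<Sum>\<tau> | \<tau> permutes X. (\<Sum>\<sigma> | \<sigma> permutes Y \<tau>. F (\<sigma> \<circ> \<tau>)) / fact (card (Y \<tau>)))"
proof -
  define P where "P = {\<tau>. \<tau> permutes X}"
  have fin: "finite P" unfolding P_def using assms(1) by (rule finite_permutations)
  have block: "(\<Sum>\<tau> | \<tau> \<in> P \<and> Y \<tau> = Z. (\<Sum>\<sigma> | \<sigma> permutes Y \<tau>. F (\<sigma> \<circ> \<tau>)) / fact (card (Y \<tau>)))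
      = (\<Sum>\<tau> | \<tau> \<in> P \<and> Y \<tau> = Z. F \<tau>)" if Z: "Z \<in> Y ` P" for Z
  proof -
    have ZX: "Z \<subseteq> X" using Z sub by (auto simp: P_def)
    then have finZ: "finite Z" using assms(1) finite_subset by blast
    have shift: "(\<Sum>\<tau> | \<tau> \<in> P \<and> Y \<tau> = Z. F (\<sigma> \<circ> \<tau>)) = (\<Sum>\<tau> | \<tau> \<in> P \<and> Y \<tau> = Z. F \<tau>)"
      if \<sigma>: "\<sigma> permutes Z" for \<sigma>
    proof (rule sum.reindex_bij_witness[where i = "\<lambda>\<tau>. Hilbert_Choice.inv \<sigma> \<circ> \<tau>" and j = "\<lambda>\<tau>. \<sigma> \<circ> \<tau>"])
      note \<sigma>' = permutes_inv[OF \<sigma>]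
      have \<sigma>X: "\<sigma> permutes X" "Hilbert_Choice.inv \<sigma> permutes X"
        using permutes_subset[OF \<sigma> ZX] permutes_subset[OF \<sigma>' ZX] by auto
      fix \<tau>
      assume "\<tau> \<in> {\<tau> \<in> P. Y \<tau> = Z}"
      then show "Hilbert_Choice.inv \<sigma> \<circ> (\<sigma> \<circ> \<tau>) = \<tau>" "\<sigma> \<circ> \<tau> \<in> {\<tau> \<in> P. Y \<tau> = Z}"
        "\<sigma> \<circ> (Hilbert_Choice.inv \<sigma> \<circ> \<tau>) = \<tau>" "Hilbert_Choice.inv \<sigma> \<circ> \<tau> \<in> {\<tau> \<in> P. Y \<tau> = Z}"
        using inv[of \<tau> \<sigma>] inv[of \<tau> "Hilbert_Choice.inv \<sigma>"] \<sigma> \<sigma>' \<sigma>X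
        by (auto simp: P_def fun_eq_iff permutes_inverses[OF \<sigma>] intro: permutes_compose)
    qed auto
    have "(\<Sum>\<tau> | \<tau> \<in> P \<and> Y \<tau> = Z. (\<Sum>\<sigma> | \<sigma> permutes Y \<tau>. F (\<sigma> \<circ> \<tau>)) / fact (card (Y \<tau>)))
        = (\<Sum>\<tau> | \<tau> \<in> P \<and> Y \<tau> = Z. (\<Sum>\<sigma> | \<sigma> permutes Z. F (\<sigma> \<circ> \<tau>))) / fact (card Z)"
      by (simp add: sum_divide_distrib)
    also have "\<dots> = (\<Sum>\<sigma> | \<sigma> permutes Z. \<Sum>\<tau> | \<tau> \<in> P \<and> Y \<tau> = Z. F (\<sigma> \<circ> \<tau>)) / fact (card Z)"
      by (subst sum.swap) simp
    also have "\<dots> = (\<Sum>\<tau> | \<tau> \<in> P \<and> Y \<tau> = Z. F \<tau>)"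
      using shift finZ by (simp add: card_permutations)
    finally show ?thesis .
  qed
  have "(\<Sum>\<tau>\<in>P. F \<tau>) = (\<Sum>Z\<in>Y ` P. \<Sum>\<tau> | \<tau> \<in> P \<and> Y \<tau> = Z. F \<tau>)"
    using fin by (rule sum.image_gen)
  also have "\<dots> = (\<Sum>Z\<in>Y ` P. \<Sum>\<tau> | \<tau> \<in> P \<and> Y \<tau> = Z.
      (\<Sum>\<sigma> | \<sigma> permutes Y \<tau>. F (\<sigma> \<circ> \<tau>)) / fact (card (Y \<tau>)))"
    using block by simp
  also have "\<dots> = (\<Sum>\<tau>\<in>P. (\<Sum>\<sigma> | \<sigma> permutes Y \<tau>. F (\<sigma> \<circ> \<tau>)) / fact (card (Y \<tau>)))"
    using sum.image_gen[OF fin, symmetric] .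
  finally show ?thesis by (simp add: P_def)
qed

section \<open>Sums over pairs of pivot ranks\<close>

lemma sum_offdiagonal:
  fixes K :: "nat \<Rightarrow> nat \<Rightarrow> real"
  assumes "\<And>i j. K i j = K j i"
  shows "(\<Sum>i<n. \<Sum>j\<in>{..<n} - {i}. K i j) = 2 * (\<Sum>j<n. \<Sum>i<j. K i j)"
proof (induction n)
  case (Suc n)
  have "(\<Sum>j\<in>{..<Suc n} - {i}. K i j) = (\<Sum>j\<in>{..<n} - {i}. K i j) + K i n" if "i < n" for i
  proof -
    have "{..<Suc n} - {i} = insert n ({..<n} - {i})" using that by auto
    then show ?thesis by simp
  qed
  moreover have "{..<Suc n} - {n} = {..<n}" by auto
  ultimately show ?case using Suc assms[of n] by (simp add: sum.distrib)
qed simp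

text \<open>Along the increasing enumeration of \<open>X\<close>, pivots of ranks i < j leave i
  smaller values, j - i - 1 between them and |X| - 1 - j larger ones. The factor 2 accounts for the
  two orders in which the pivots can stand at the ends.\<close>

lemma sum_pairs_by_rank:
  fixes G :: "nat \<Rightarrow> nat \<Rightarrow> nat \<Rightarrow> real" and X :: "int set"
  assumes "finite X"
  shows "(\<Sum>a\<in>X. \<Sum>b\<in>X - {a}. G (card {x \<in> X. x < min a b})
      (card {x \<in> X. min a b < x \<and> x < max a b}) (card {x \<in> X. max a b < x}))
    = 2 * (\<Sum>j<card X. \<Sum>i<j. G i (j - i - 1) (card X - 1 - j))"
proof -
  define n where "n = card X"
  define e where "e i = sorted_list_of_set X ! i" for i
  have e: "bij_betw e {..<n} X" "strict_mono_on {..<n} e"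
    using assms sorted_wrt_nth_less[OF strict_sorted_list_of_set[of X]]
    unfolding e_def n_def by (auto intro!: strict_mono_onI bij_betw_nth)
  have mono: "e i < e j \<longleftrightarrow> i < j" if "i < n" "j < n" for i j
    using strict_mono_on_less[OF e(2)] that by auto
  have img: "X = e ` {..<n}" using e(1) by (auto simp: bij_betw_def)
  have inj: "inj_on e {..<n}" using e(1) by (auto simp: bij_betw_def)
  have card: "card {x \<in> X. Q x} = card {k. k < n \<and> Q (e k)}" for Q
  proof -
    have "{x \<in> X. Q x} = e ` {k. k < n \<and> Q (e k)}" by (auto simp: img)
    then show ?thesis using inj by (auto intro: card_image inj_on_subset)
  qed
  define H where "H a b = G (card {x \<in> X. x < min a b})
      (card {x \<in> X. min a b < x \<and> x < max a b}) (card {x \<in> X. max a b < x})" for a b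
  have Hsym: "H a b = H b a" for a b by (simp add: H_def min.commute max.commute)
  have H: "H (e i) (e j) = G i (j - i - 1) (n - 1 - j)" if "i < j" "j < n" for i j
  proof -
    have m: "min (e i) (e j) = e i" "max (e i) (e j) = e j"
      using mono[of i j] that by auto
    have "{k. k < n \<and> e k < e i} = {..<i}" "{k. k < n \<and> e i < e k \<and> e k < e j} = {i<..<j}"
      "{k. k < n \<and> e j < e k} = {j<..<n}"
      using that mono by auto
    then show ?thesis by (simp add: H_def m card)
  qed
  have "(\<Sum>a\<in>X. \<Sum>b\<in>X - {a}. H a b) = (\<Sum>i<n. \<Sum>b\<in>X - {e i}. H (e i) b)"
    by (rule sum.reindex_bij_betw[OF e(1), symmetric])
  also have "\<dots> = (\<Sum>i<n. \<Sum>j\<in>{..<n} - {i}. H (e i) (e j))"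
  proof (intro sum.cong refl)
    fix i assume "i \<in> {..<n}"
    then have "bij_betw e ({..<n} - {i}) (X - {e i})"
      using e(1) by (intro bij_betw_DiffI) (auto simp: bij_betw_def)
    then show "(\<Sum>b\<in>X - {e i}. H (e i) b) = (\<Sum>j\<in>{..<n} - {i}. H (e i) (e j))"
      by (rule sum.reindex_bij_betw[symmetric])
  qed
  also have "\<dots> = 2 * (\<Sum>j<n. \<Sum>i<j. H (e i) (e j))"
    by (rule sum_offdiagonal) (rule Hsym)
  also have "(\<Sum>j<n. \<Sum>i<j. H (e i) (e j)) = (\<Sum>j<n. \<Sum>i<j. G i (j - i - 1) (n - 1 - j))"
    using H by (intro sum.cong refl) auto
  finally show ?thesis by (simp add: H_def n_def)
qed

text \<open>Every old weight grows by one and the new term has weight 0. Applied twice, this also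
  removes the sum from the recurrence for the mean cost.\<close>

lemma sum_weighted_Suc:
  fixes E :: "nat \<Rightarrow> real"
  shows "(\<Sum>k<Suc n. real (Suc n - 1 - k) * E k) = (\<Sum>k<n. real (n - 1 - k) * E k) + (\<Sum>k<n. E k)"
proof -
  have "(\<Sum>k<Suc n. real (Suc n - 1 - k) * E k) = (\<Sum>k<n. real (n - k) * E k)" by simp
  also have "\<dots> = (\<Sum>k<n. real (n - 1 - k) * E k + E k)"
  proof (intro sum.cong refl)
    fix k assume "k \<in> {..<n}"
    then have "n - k = Suc (n - 1 - k)" by auto
    then show "real (n - k) * E k = real (n - 1 - k) * E k + E k"
      by (simp add: algebra_simps)
  qed
  finally show ?thesis by (simp add: sum.distrib)
qed

text \<open>The three gaps cut out by a pair of ranks are equally distributed: each of them has size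
  k for exactly n - 1 - k of the pairs.\<close>

lemma sum_three_parts:
  fixes E :: "nat \<Rightarrow> real"
  shows "(\<Sum>j<n. \<Sum>i<j. E i + E (j - i - 1) + E (n - 1 - j)) = 3 * (\<Sum>k<n. real (n - 1 - k) * E k)"
proof -
  have 1: "(\<Sum>j<n. \<Sum>i<j. E i) = (\<Sum>k<n. real (n - 1 - k) * E k)"
  proof (induction n)
    case (Suc n)
    then show ?case by (subst sum_weighted_Suc) simp
  qed simp
  have 2: "(\<Sum>i<j. E (j - i - 1)) = (\<Sum>i<j. E i)" for j
    using sum.nat_diff_reindex[of E j] by simp
  have 3: "(\<Sum>j<n. \<Sum>i<j. E (n - 1 - j)) = (\<Sum>k<n. real (n - 1 - k) * E k)"
  proof -
    have "(\<Sum>j<n. \<Sum>i<j. E (n - 1 - j)) = (\<Sum>j<n. real (n - 1 - (n - Suc j)) * E (n - Suc j))"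
      by (intro sum.cong refl) auto
    also have "\<dots> = (\<Sum>k<n. real (n - 1 - k) * E k)"
      by (rule sum.nat_diff_reindex[of "\<lambda>k. real (n - 1 - k) * E k"])
    finally show ?thesis .
  qed
  show ?thesis unfolding sum.distrib 1 2 3 by simp
qed

text \<open>Mean cost of partitioning \<open>n\<close> elements given \<open>s\<close> small and \<open>l\<close> large ones. The quotients are
  the expected numbers of large elements visited by \<open>k\<close> and of small ones visited by \<open>g\<close>; for \<open>n = 2\<close>
  they are \<open>0 / 0 = 0\<close>.\<close>

definition toll :: "real \<Rightarrow> real \<Rightarrow> nat \<Rightarrow> nat \<Rightarrow> nat \<Rightarrow> real" where
  "toll \<alpha> \<beta> n s l = (let N = real n - 2 in
     \<alpha> * (2 + real s + real l * (N - real l + 1) / N) +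
     \<beta> * (4 + 2 * real s + 2 * (real l * (N - real l + 1) / N) - real l * real s / N))"

text \<open>For \<open>n = 2\<close> there is nothing between the pivots and the linear formula fails.\<close>

definition mean_toll :: "real \<Rightarrow> real \<Rightarrow> nat \<Rightarrow> real" where
  "mean_toll \<alpha> \<beta> n = (if n = 2 then 2 * \<alpha> + 4 * \<beta>
     else \<alpha> * (real n / 2 + 7/6) + \<beta> * (11/12 * real n + 31/12))"

lemma sum_power_lessThan:
  "(\<Sum>j<n. real j) = real n * (real n - 1) / 2"
  "(\<Sum>j<n. real j ^ 2) = real n * (real n - 1) * (2 * real n - 1) / 6"
  "(\<Sum>j<n. real j ^ 3) = (real n * (real n - 1) / 2) ^ 2"
  by (induction n; simp add: field_simps power2_eq_square power3_eq_cube)+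

text \<open>Averaged over all pairs of ranks, there are (n - 2)/3 small elements, (n - 1)/6 large
  ones met by \<open>k\<close> and (n - 3)/12 small ones met by \<open>g\<close>. Inserting these
  means into the cost of a step gives the constants of \<open>mean_toll\<close>. The last two come
  from power sums that contain the factor n - 2, which cancels the denominator of
  \<open>toll\<close>.\<close>

lemma sum_toll:
  assumes "2 \<le> n"
  shows "(\<Sum>j<n. \<Sum>i<j. toll \<alpha> \<beta> n i (n - 1 - j)) = real n * (real n - 1) / 2 * mean_toll \<alpha> \<beta> n"
proof (cases "n = 2")
  case True
  have "{..<2::nat} = {0, 1}" "{..<Suc 0} = {0}" by auto
  then show ?thesis unfolding True by (simp add: toll_def mean_toll_def)
next
  case False
  define x where "x = real n"
  have N: "x - 2 \<noteq> 0" using assms False by (simp add: x_def)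
  have "(\<Sum>i<j. toll \<alpha> \<beta> n i (n - 1 - j)) =
      (2 * \<alpha> + 4 * \<beta>) * real j + (\<alpha> + 2 * \<beta>) * ((real j ^ 2 - real j) / 2)
      + (\<alpha> + 2 * \<beta>) / (x - 2) * ((x - 1) * real j ^ 2 - real j ^ 3)
      - \<beta> / (2 * (x - 2)) * (x * real j ^ 2 - (x - 1) * real j - real j ^ 3)" if "j < n" for j
  proof -
    define L where "L = x - 1 - real j"
    have l: "real (n - Suc j) = L" using that by (simp add: x_def L_def)
    have "toll \<alpha> \<beta> n i (n - 1 - j) = (2 * \<alpha> + 4 * \<beta> + (\<alpha> + 2 * \<beta>) * (L * (x - 1 - L) / (x - 2)))
        + (\<alpha> + 2 * \<beta> - \<beta> * L / (x - 2)) * real i" for i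
      by (simp add: toll_def l Let_def flip: x_def) (simp add: algebra_simps flip: add_divide_distrib)
    then have "(\<Sum>i<j. toll \<alpha> \<beta> n i (n - 1 - j)) =
        real j * (2 * \<alpha> + 4 * \<beta> + (\<alpha> + 2 * \<beta>) * (L * (x - 1 - L) / (x - 2)))
        + (\<alpha> + 2 * \<beta> - \<beta> * L / (x - 2)) * (real j * (real j - 1) / 2)"
      by (simp add: sum.distrib sum_power_lessThan flip: sum_distrib_left)
    also have "\<dots> = (2 * \<alpha> + 4 * \<beta>) * real j + (\<alpha> + 2 * \<beta>) * ((real j ^ 2 - real j) / 2)
      + (\<alpha> + 2 * \<beta>) / (x - 2) * ((x - 1) * real j ^ 2 - real j ^ 3)
      - \<beta> / (2 * (x - 2)) * (x * real j ^ 2 - (x - 1) * real j - real j ^ 3)"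
    proof -
      define N where "N = x - 2"
      have x: "x = N + 2" and "N \<noteq> 0" using N by (auto simp: N_def)
      then show ?thesis unfolding L_def x
        by (simp add: divide_simps) (simp add: algebra_simps power2_eq_square power3_eq_cube)
    qed
    finally show ?thesis .
  qed
  then have "(\<Sum>j<n. \<Sum>i<j. toll \<alpha> \<beta> n i (n - 1 - j)) = (\<Sum>j<n.
      (2 * \<alpha> + 4 * \<beta>) * real j + (\<alpha> + 2 * \<beta>) * ((real j ^ 2 - real j) / 2)
      + (\<alpha> + 2 * \<beta>) / (x - 2) * ((x - 1) * real j ^ 2 - real j ^ 3)
      - \<beta> / (2 * (x - 2)) * (x * real j ^ 2 - (x - 1) * real j - real j ^ 3))"
    by simp
  also have "\<dots> = (2 * \<alpha> + 4 * \<beta>) * (\<Sum>j<n. real j) + (\<alpha> + 2 * \<beta>) * (((\<Sum>j<n. real j ^ 2) - (\<Sum>j<n. real j)) / 2)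
      + (\<alpha> + 2 * \<beta>) / (x - 2) * ((x - 1) * (\<Sum>j<n. real j ^ 2) - (\<Sum>j<n. real j ^ 3))
      - \<beta> / (2 * (x - 2)) * (x * (\<Sum>j<n. real j ^ 2) - (x - 1) * (\<Sum>j<n. real j) - (\<Sum>j<n. real j ^ 3))"
    by (simp add: sum.distrib sum_subtractf flip: sum_distrib_left sum_divide_distrib)
  also have "\<dots> = x * (x - 1) / 2 * mean_toll \<alpha> \<beta> n"
  proof -
    define N where "N = x - 2"
    have x: "x = N + 2" and "N \<noteq> 0" using N by (auto simp: N_def)
    then show ?thesis using False unfolding sum_power_lessThan mean_toll_def x_def[symmetric] x
      by (simp add: divide_simps) (simp add: algebra_simps power2_eq_square power3_eq_cube)
  qed
  finally show ?thesis by (simp add: x_def)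
qed

subsection \<open>The recurrence for the mean cost\<close>

text \<open>A linear combination lets one recurrence serve both counters. Swaps are recovered with
  \<open>\<alpha> = 1\<close>, \<open>\<beta> = 0\<close> and writes with
  \<open>\<alpha> = 0\<close>, \<open>\<beta> = 1\<close>.\<close>

definition cost :: "real \<Rightarrow> real \<Rightarrow> state \<Rightarrow> real" where
  "cost \<alpha> \<beta> s = \<alpha> * real (swaps s) + \<beta> * real (writes s)"

definition initial :: "(int \<Rightarrow> int) \<Rightarrow> state" where
  "initial A = \<lparr>arr = A, swaps = 0, writes = 0\<rparr>"

lemma initial_simps [simp]: "arr (initial A) = A" "swaps (initial A) = 0" "writes (initial A) = 0"
  by (simp_all add: initial_def)

definition qcost :: "real \<Rightarrow> real \<Rightarrow> nat \<Rightarrow> int \<Rightarrow> int \<Rightarrow> (int \<Rightarrow> int) \<Rightarrow> real" where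
  "qcost \<alpha> \<beta> M left right A = cost \<alpha> \<beta> (quicksort M left right (initial A))"

lemma qcost_quicksort:
  assumes "\<And>i. i \<in> {left..right} \<Longrightarrow> arr s i = A i"
  shows "cost \<alpha> \<beta> (quicksort M left right s) = cost \<alpha> \<beta> s + qcost \<alpha> \<beta> M left right A"
proof -
  have "sim (\<lambda>x. x) {left..right} (int (swaps s)) (int (writes s)) (initial A) s"
    using assms by (auto simp: sim_def)
  from quicksort_sim[OF this, of M] show ?thesis
    by (simp add: sim_def qcost_def cost_def flip: of_nat_add) (simp add: algebra_simps)
qed

lemma qcost_cong:
  "(\<And>i. i \<in> {left..right} \<Longrightarrow> A i = B i) \<Longrightarrow> qcost \<alpha> \<beta> M left right A = qcost \<alpha> \<beta> M left right B"
  using qcost_quicksort[of left right "initial A" B \<alpha> \<beta> M]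
  by (simp add: qcost_def) (simp add: cost_def)

text \<open>The second and third calls start from an array that earlier calls have changed, but only
  outside their own segments. By locality all three costs may be evaluated on the array that the
  partitioning step left.\<close>

lemma qcost_partition:
  assumes "\<not> right - left < int M" "partition_step left right (initial A) = (l, g, s)" "l < g"
  shows "qcost \<alpha> \<beta> M left right A = cost \<alpha> \<beta> s + qcost \<alpha> \<beta> M left (l - 1) (arr s)
    + qcost \<alpha> \<beta> M (l + 1) (g - 1) (arr s) + qcost \<alpha> \<beta> M (g + 1) right (arr s)"
proof -
  define s2 where "s2 = quicksort M left (l - 1) s"
  define s3 where "s3 = quicksort M (l + 1) (g - 1) s2"
  have "qcost \<alpha> \<beta> M left right A = cost \<alpha> \<beta> (quicksort M (g + 1) right s3)"
    using assms unfolding qcost_def by (subst quicksort.simps) (simp add: s2_def s3_def)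
  also have "\<dots> = cost \<alpha> \<beta> s3 + qcost \<alpha> \<beta> M (g + 1) right (arr s)"
    using assms(3) by (intro qcost_quicksort) (simp add: s2_def s3_def quicksort_outside)
  also have "cost \<alpha> \<beta> s3 = cost \<alpha> \<beta> s2 + qcost \<alpha> \<beta> M (l + 1) (g - 1) (arr s)"
    using assms(3) unfolding s3_def by (intro qcost_quicksort) (simp add: s2_def quicksort_outside)
  also have "cost \<alpha> \<beta> s2 = cost \<alpha> \<beta> s + qcost \<alpha> \<beta> M left (l - 1) (arr s)"
    unfolding s2_def by (intro qcost_quicksort) simp
  finally show ?thesis by simp
qed

section \<open>Means over the relabellings of one segment\<close>

lemma cnt_eq_sum: "real (cnt P a b) = (\<Sum>i\<in>{a..b}. of_bool (P i))"
  by (simp add: cnt_def sum_of_bool_eq Int_def)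

lemma cnt_inj_on:
  assumes "inj_on A {a..b}"
  shows "cnt (\<lambda>i. P (A i)) a b = card {x \<in> A ` {a..b}. P x}"
proof -
  have "{x \<in> A ` {a..b}. P x} = A ` {i \<in> {a..b}. P (A i)}" by auto
  moreover have "inj_on A {i \<in> {a..b}. P (A i)}" by (rule inj_on_subset[OF assms]) auto
  ultimately show ?thesis unfolding cnt_def by (simp only: card_image)
qed

lemma card_inj_on_interval: "inj_on A {a..b} \<Longrightarrow> card (A ` {a..b}) = nat (b + 1 - a)" for a b :: int
  by (simp add: card_image)

lemma permutes_comp_inj_on: "\<tau> permutes X \<Longrightarrow> inj_on A I \<Longrightarrow> inj_on (\<tau> \<circ> A) I"
  by (auto intro: comp_inj_on permutes_inj_on)

lemma permutes_comp_image: "\<tau> permutes A ` I \<Longrightarrow> (\<tau> \<circ> A) ` I = A ` I"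
  by (metis image_comp permutes_image)

text \<open>Composition on the right with the transposition of \<open>x\<close> and \<open>y\<close>
  matches the permutations that put the two in order with those that invert them.\<close>

lemma mean_inversion:
  fixes x y :: int
  assumes "finite X" "x \<in> X" "y \<in> X" "x \<noteq> y"
  shows "(\<Sum>\<tau> | \<tau> permutes X. of_bool (\<tau> x < \<tau> y)) = (fact (card X) / 2 :: real)"
proof -
  let ?t = "Transposition.transpose x y"
  have t: "?t permutes X" using assms by (intro permutes_swap_id)
  have "(\<Sum>\<tau> | \<tau> permutes X. of_bool (\<tau> x < \<tau> y)) = (\<Sum>\<tau> | \<tau> permutes X. of_bool (\<tau> y < \<tau> x) :: real)"
    by (rule sum.reindex_bij_witness[where i = "\<lambda>\<tau>. \<tau> \<circ> ?t" and j = "\<lambda>\<tau>. \<tau> \<circ> ?t"])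
      (auto intro: permutes_compose[OF t] simp: comp_assoc)
  moreover have "(\<Sum>\<tau> | \<tau> permutes X. of_bool (\<tau> x < \<tau> y) + of_bool (\<tau> y < \<tau> x)) = (\<Sum>\<tau> | \<tau> permutes X. 1 :: real)"
  proof (intro sum.cong refl)
    fix \<tau> assume "\<tau> \<in> {\<tau>. \<tau> permutes X}"
    then have "\<tau> x \<noteq> \<tau> y" using assms permutes_inj[of \<tau> X] by (auto simp: inj_eq)
    then show "of_bool (\<tau> x < \<tau> y) + of_bool (\<tau> y < \<tau> x) = (1 :: real)" by auto
  qed
  ultimately show ?thesis using assms by (simp add: sum.distrib card_permutations)
qed

lemma sum_insertion_sort:
  assumes inj: "inj_on A {left..right}" and n: "n = nat (right + 1 - left)" and small: "right - left < int M"
  shows "(\<Sum>\<tau> | \<tau> permutes A ` {left..right}. qcost \<alpha> \<beta> M left right (\<tau> \<circ> A))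
    = fact n * (\<beta> * (real n * (real n - 1) / 4 + real (n - 1)))"
proof (cases "right < left")
  case True
  \<comment> \<open>For an empty segment \<open>n\<close> is 0, and truncated subtraction makes
    \<open>real (n - 1)\<close> equal to 0, as it should be.\<close>
  then have "[left + 1..right] = []" by auto
  then show ?thesis using True small n
    by (simp add: qcost_def quicksort.simps insertion_sort_def cost_def)
next
  case False
  define X where "X = A ` {left..right}"
  have X: "finite X" "card X = n"
    using inj by (auto simp: X_def n card_inj_on_interval)
  have q: "qcost \<alpha> \<beta> M left right B = \<beta> * (\<Sum>i\<in>{left+1..right}. 1 + (\<Sum>j\<in>{left..i-1}. of_bool (B i < B j)))" for B
    using insertion_sort_result[of left right "initial B"] False small
    by (simp add: qcost_def quicksort.simps cost_def cnt_eq_sum)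
  have inv: "(\<Sum>\<tau> | \<tau> permutes X. of_bool (\<tau> (A i) < \<tau> (A j))) = (fact n / 2 :: real)"
    if "i \<in> {left+1..right}" "j \<in> {left..i-1}" for i j
    using mean_inversion[of X "A i" "A j"] X that inj_onD[OF inj, of i j] by (force simp: X_def)
  have "(\<Sum>\<tau> | \<tau> permutes X. qcost \<alpha> \<beta> M left right (\<tau> \<circ> A)) = \<beta> *
      (\<Sum>i\<in>{left+1..right}. (\<Sum>\<tau> | \<tau> permutes X. 1) +
        (\<Sum>j\<in>{left..i-1}. \<Sum>\<tau> | \<tau> permutes X. of_bool (\<tau> (A i) < \<tau> (A j))))"
    unfolding q sum_distrib_left[symmetric]
    by (subst sum.swap, subst sum.distrib, subst sum.swap) (simp add: sum.distrib)
  also have "\<dots> = \<beta> * (\<Sum>i\<in>{left+1..right}. fact n * (1 + real_of_int (i - left) / 2))"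
    using X by (simp add: inv card_permutations algebra_simps)
  also have "(\<Sum>i\<in>{left+1..right}. fact n * (1 + real_of_int (i - left) / 2)) =
      (\<Sum>m\<in>{1..n-1}. fact n * (1 + real m / 2))"
    by (rule sum.reindex_bij_witness[where i = "\<lambda>m. left + int m" and j = "\<lambda>i. nat (i - left)"])
      (use n in auto)
  also have "\<dots> = fact n * (real n * (real n - 1) / 4 + real (n - 1))"
  proof -
    have "(\<Sum>m\<in>{1..k}. 1 + real m / 2) = real (Suc k) * real k / 4 + real k" for k
      by (induction k) (auto simp: field_simps)
    from this[of "n - 1"] show ?thesis using False n
      by (simp add: of_nat_diff flip: sum_distrib_left)
  qed
  finally show ?thesis by (simp add: X_def comp_def mult.left_commute)
qed

text \<open>Up to \<open>M\<close> elements the writes of Insertionsort are n(n-1)/4 inversions on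
  average and n - 1 final writes; there are no swaps. Above \<open>M\<close>, a given subarray has
  size k with probability (n - 1 - k) divided by n(n-1)/2, and three subarrays together give the
  factor 6.\<close>

fun avg_cost :: "real \<Rightarrow> real \<Rightarrow> nat \<Rightarrow> nat \<Rightarrow> real" where
  "avg_cost \<alpha> \<beta> M n = (if n \<le> M then \<beta> * (real n * (real n - 1) / 4 + real (n - 1))
     else mean_toll \<alpha> \<beta> n
       + 6 / (real n * (real n - 1)) * (\<Sum>k\<in>{..<n}. real (n - 1 - k) * avg_cost \<alpha> \<beta> M k))"

declare avg_cost.simps [simp del]

lemma order_preserving:
  fixes p q :: int
  assumes "\<sigma> permutes Y" "p < q"
    and "Y \<subseteq> {x. x < p} \<or> Y \<subseteq> {x. p < x \<and> x < q} \<or> Y \<subseteq> {x. q < x}"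
  shows "(\<sigma> x < p) = (x < p)" "(\<sigma> x < q) = (x < q)" "(\<sigma> x > q) = (x > q)" "\<sigma> p = p" "\<sigma> q = q"
proof -
  have *: "(\<sigma> x \<in> Y) = (x \<in> Y)" "x \<notin> Y \<Longrightarrow> \<sigma> x = x" for x
    using permutes_in_image[OF assms(1)] permutes_not_in[OF assms(1)] by auto
  show "\<sigma> p = p" "\<sigma> q = q" using assms(2,3) by (auto intro!: *(2))
  show "(\<sigma> x < p) = (x < p)" "(\<sigma> x < q) = (x < q)" "(\<sigma> x > q) = (x > q)"
    using assms(2,3) * [of x] by (cases "x \<in> Y"; fastforce)+
qed

text \<open>One step on \<open>\<tau> \<circ> A\<close> for a relabelling \<open>\<tau>\<close> of
  the values \<open>X\<close>. Pivots, classes, final positions and resulting state are all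
  functions of \<open>\<tau>\<close>, so that each can be compared at \<open>\<tau>\<close> and at
  \<open>\<sigma> \<circ> \<tau>\<close>.\<close>

locale partitioning =
  fixes A :: "int \<Rightarrow> int" and left right :: int and n :: nat
  assumes inj: "inj_on A {left..right}" and n_def: "n = nat (right + 1 - left)" and lr: "left < right"
begin

definition "X = A ` {left..right}"
definition "p \<tau> = min (\<tau> (A left)) (\<tau> (A right))" for \<tau> :: "int \<Rightarrow> int"
definition "q \<tau> = max (\<tau> (A left)) (\<tau> (A right))" for \<tau> :: "int \<Rightarrow> int"
definition "pos_p \<tau> = fst (partition_step left right (initial (\<tau> \<circ> A)))"
definition "pos_q \<tau> = fst (snd (partition_step left right (initial (\<tau> \<circ> A))))"
definition "after \<tau> = snd (snd (partition_step left right (initial (\<tau> \<circ> A))))"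
definition "small \<tau> = {x \<in> X. x < p \<tau>}"
definition "medium \<tau> = {x \<in> X. p \<tau> < x \<and> x < q \<tau>}"
definition "large \<tau> = {x \<in> X. q \<tau> < x}"

lemma finite_X: "finite X" and card_X: "card X = n"
  using inj by (auto simp: X_def n_def card_inj_on_interval)

lemma step_eq: "partition_step left right (initial (\<tau> \<circ> A)) = (pos_p \<tau>, pos_q \<tau>, after \<tau>)"
  by (simp add: pos_p_def pos_q_def after_def)

lemma step_result:
  assumes "\<tau> permutes X"
  shows "rearranged {left..right} (\<tau> \<circ> A) (arr (after \<tau>))" "left \<le> pos_p \<tau>" "pos_p \<tau> < pos_q \<tau>" "pos_q \<tau> \<le> right"
    "arr (after \<tau>) (pos_p \<tau>) = p \<tau>" "arr (after \<tau>) (pos_q \<tau>) = q \<tau>"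
    "\<And>i. i \<in> {left..<pos_p \<tau>} \<Longrightarrow> arr (after \<tau>) i < p \<tau>"
    "\<And>i. i \<in> {pos_p \<tau><..<pos_q \<tau>} \<Longrightarrow> p \<tau> < arr (after \<tau>) i \<and> arr (after \<tau>) i < q \<tau>"
    "\<And>i. i \<in> {pos_q \<tau><..right} \<Longrightarrow> q \<tau> < arr (after \<tau>) i"
    "swaps (after \<tau>) = 2 + cnt (\<lambda>i. \<tau> (A i) < p \<tau>) (left + 1) (right - 1)
       + cnt (\<lambda>i. q \<tau> < \<tau> (A i)) (left + 1) (min (right - 1) (pos_q \<tau>))"
    "writes (after \<tau>) + cnt (\<lambda>i. \<tau> (A i) < p \<tau>) (pos_q \<tau>) (right - 1) = 4
       + 2 * cnt (\<lambda>i. \<tau> (A i) < p \<tau>) (left + 1) (right - 1)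
       + 2 * cnt (\<lambda>i. q \<tau> < \<tau> (A i)) (left + 1) (min (right - 1) (pos_q \<tau>))"
  using partition_step_result[OF lr _ step_eq[of \<tau>], of "p \<tau>" "q \<tau>"]
    permutes_comp_inj_on[OF assms inj] by (auto simp: p_def q_def)

lemma pivots_less: "\<tau> permutes X \<Longrightarrow> p \<tau> < q \<tau>"
proof -
  assume "\<tau> permutes X"
  then have "\<tau> (A left) \<noteq> \<tau> (A right)"
    using inj_onD[OF permutes_comp_inj_on[OF _ inj], of \<tau> X left right] lr by auto
  then show ?thesis by (auto simp: p_def q_def)
qed

text \<open>The inequalities put every entry of a segment into the right class, and the whole range
  still carries exactly \<open>X\<close>. Hence each segment carries all of its class.\<close>

lemma parts:
  assumes \<tau>: "\<tau> permutes X"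
  shows "inj_on (arr (after \<tau>)) {left..right}"
    "arr (after \<tau>) ` {left..pos_p \<tau> - 1} = small \<tau>"
    "arr (after \<tau>) ` {pos_p \<tau> + 1..pos_q \<tau> - 1} = medium \<tau>"
    "arr (after \<tau>) ` {pos_q \<tau> + 1..right} = large \<tau>"
proof -
  note R = step_result[OF \<tau>] and pq = pivots_less[OF \<tau>]
  show "inj_on (arr (after \<tau>)) {left..right}"
    using rearranged_inj_on[OF R(1)] permutes_comp_inj_on[OF \<tau> inj] by blast
  have X: "X = arr (after \<tau>) ` {left..right}"
    using rearranged_image[OF R(1)] permutes_comp_image[of \<tau> A "{left..right}"] \<tau> by (simp add: X_def)
  have split: "{left..right} = {left..pos_p \<tau> - 1} \<union> {pos_p \<tau>} \<union> {pos_p \<tau> + 1..pos_q \<tau> - 1} \<union> {pos_q \<tau>} \<union> {pos_q \<tau> + 1..right}"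
    using R(2-4) by auto
  have X': "X = arr (after \<tau>) ` {left..pos_p \<tau> - 1} \<union> {p \<tau>} \<union> arr (after \<tau>) ` {pos_p \<tau> + 1..pos_q \<tau> - 1}
      \<union> {q \<tau>} \<union> arr (after \<tau>) ` {pos_q \<tau> + 1..right}"
    unfolding X split by (simp add: image_Un R(5,6) Un_ac)
  have 1: "x < p \<tau>" if "x \<in> arr (after \<tau>) ` {left..pos_p \<tau> - 1}" for x
    using that R(7) by force
  have 2: "p \<tau> < x \<and> x < q \<tau>" if "x \<in> arr (after \<tau>) ` {pos_p \<tau> + 1..pos_q \<tau> - 1}" for x
    using that R(8) by force
  have 3: "q \<tau> < x" if "x \<in> arr (after \<tau>) ` {pos_q \<tau> + 1..right}" for x
    using that R(9) by force
  show "arr (after \<tau>) ` {left..pos_p \<tau> - 1} = small \<tau>"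
    "arr (after \<tau>) ` {pos_p \<tau> + 1..pos_q \<tau> - 1} = medium \<tau>"
    "arr (after \<tau>) ` {pos_q \<tau> + 1..right} = large \<tau>"
    unfolding small_def medium_def large_def using 1 2 3 pq
    by (subst X'; fastforce)+
qed

text \<open>The final positions of the pivots are thereby functions of their ranks, so any
  relabelling that fixes both pivots preserves them, even if it changes the course of the
  loop.\<close>

lemma card_parts:
  assumes \<tau>: "\<tau> permutes X"
  shows "int (card (small \<tau>)) = pos_p \<tau> - left" "int (card (medium \<tau>)) = pos_q \<tau> - pos_p \<tau> - 1"
    "int (card (large \<tau>)) = right - pos_q \<tau>"
proof -
  note R = step_result(2-4)[OF \<tau>]
  have "inj_on (arr (after \<tau>)) I" if "I \<subseteq> {left..right}" for I
    using parts(1)[OF \<tau>] that inj_on_subset by blast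
  then show "int (card (small \<tau>)) = pos_p \<tau> - left" "int (card (medium \<tau>)) = pos_q \<tau> - pos_p \<tau> - 1"
    "int (card (large \<tau>)) = right - pos_q \<tau>"
    using R unfolding parts(2-4)[OF \<tau>, symmetric] by (subst card_inj_on_interval; auto)+
qed

lemma relabel:
  assumes \<tau>: "\<tau> permutes X" and \<sigma>: "\<sigma> permutes Y"
    and Y: "Y = small \<tau> \<or> Y = medium \<tau> \<or> Y = large \<tau>"
  shows "p (\<sigma> \<circ> \<tau>) = p \<tau>" "q (\<sigma> \<circ> \<tau>) = q \<tau>" "pos_p (\<sigma> \<circ> \<tau>) = pos_p \<tau>" "pos_q (\<sigma> \<circ> \<tau>) = pos_q \<tau>"
    "\<And>i. i \<in> {left..right} \<Longrightarrow> arr (after (\<sigma> \<circ> \<tau>)) i = \<sigma> (arr (after \<tau>) i)"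
proof -
  have Y': "Y \<subseteq> {x. x < p \<tau>} \<or> Y \<subseteq> {x. p \<tau> < x \<and> x < q \<tau>} \<or> Y \<subseteq> {x. q \<tau> < x}"
    using Y by (auto simp: small_def medium_def large_def)
  note ord = order_preserving[OF \<sigma> pivots_less[OF \<tau>] Y']
  have fixed: "\<sigma> (\<tau> (A left)) = \<tau> (A left)" "\<sigma> (\<tau> (A right)) = \<tau> (A right)"
    using ord(4,5) by (auto simp: p_def q_def min_def max_def split: if_splits)
  then show "p (\<sigma> \<circ> \<tau>) = p \<tau>" "q (\<sigma> \<circ> \<tau>) = q \<tau>"
    by (simp_all add: p_def q_def)
  have "sim \<sigma> {left..right} 0 0 (initial (\<tau> \<circ> A)) (initial (\<sigma> \<circ> \<tau> \<circ> A))"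
    by (simp add: sim_def)
  from partition_step_sim[OF this _ _ ord(4) _ ord(5,1,2,3) step_eq] obtain t where
    "partition_step left right (initial (\<sigma> \<circ> \<tau> \<circ> A)) = (pos_p \<tau>, pos_q \<tau>, t)"
    "sim \<sigma> {left..right} 0 0 (after \<tau>) t"
    using lr by (auto simp: p_def q_def)
  then show "pos_p (\<sigma> \<circ> \<tau>) = pos_p \<tau>" "pos_q (\<sigma> \<circ> \<tau>) = pos_q \<tau>"
    "\<And>i. i \<in> {left..right} \<Longrightarrow> arr (after (\<sigma> \<circ> \<tau>)) i = \<sigma> (arr (after \<tau>) i)"
    by (auto simp: pos_p_def pos_q_def after_def sim_def)
qed

text \<open>Serves all three recursive calls. A relabelling inside the class \<open>Y \<tau>\<close>
  keeps the segment bounds, which depend on the pivot positions only, and acts on the array after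
  the step. The inner sum is then the induction hypothesis for that array, and
  \<open>sum_permutes_average\<close> turns it into a term depending on the class size
  alone.\<close>

lemma sum_part:
  assumes IH: "\<And>lo hi B. left \<le> lo \<Longrightarrow> hi \<le> right \<Longrightarrow> nat (hi + 1 - lo) < n \<Longrightarrow> inj_on B {lo..hi} \<Longrightarrow>
      (\<Sum>\<sigma> | \<sigma> permutes B ` {lo..hi}. qcost \<alpha> \<beta> M lo hi (\<sigma> \<circ> B))
        = fact (nat (hi + 1 - lo)) * avg_cost \<alpha> \<beta> M (nat (hi + 1 - lo))"
    and Y: "\<And>\<tau>. \<tau> permutes X \<Longrightarrow> Y \<tau> = arr (after \<tau>) ` {lo \<tau>..hi \<tau>}"
    and Y_cases: "Y = small \<or> Y = medium \<or> Y = large"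
    and lohi: "\<And>\<tau>. \<tau> permutes X \<Longrightarrow> left \<le> lo \<tau> \<and> hi \<tau> \<le> right \<and> nat (hi \<tau> + 1 - lo \<tau>) < n"
    and eq: "\<And>\<sigma> \<tau>. pos_p \<sigma> = pos_p \<tau> \<Longrightarrow> pos_q \<sigma> = pos_q \<tau> \<Longrightarrow> lo \<sigma> = lo \<tau> \<and> hi \<sigma> = hi \<tau>"
  shows "(\<Sum>\<tau> | \<tau> permutes X. qcost \<alpha> \<beta> M (lo \<tau>) (hi \<tau>) (arr (after \<tau>)))
    = (\<Sum>\<tau> | \<tau> permutes X. avg_cost \<alpha> \<beta> M (card (Y \<tau>)))"
proof -
  let ?F = "\<lambda>\<tau>. qcost \<alpha> \<beta> M (lo \<tau>) (hi \<tau>) (arr (after \<tau>))"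
  have Y1: "Y \<tau> = small \<tau> \<or> Y \<tau> = medium \<tau> \<or> Y \<tau> = large \<tau>" for \<tau> using Y_cases by auto
  have sub: "Y \<tau> \<subseteq> X" for \<tau> using Y_cases by (auto simp: small_def medium_def large_def)
  have inv: "Y (\<sigma> \<circ> \<tau>) = Y \<tau>" if "\<tau> permutes X" "\<sigma> permutes Y \<tau>" for \<tau> \<sigma>
    using relabel(1,2)[OF that Y1] Y_cases by (auto simp: small_def medium_def large_def)
  have "(\<Sum>\<sigma> | \<sigma> permutes Y \<tau>. ?F (\<sigma> \<circ> \<tau>)) / fact (card (Y \<tau>)) = avg_cost \<alpha> \<beta> M (card (Y \<tau>))"
    if \<tau>: "\<tau> permutes X" for \<tau>
  proof -
    note lh = lohi[OF \<tau>]
    have inj': "inj_on (arr (after \<tau>)) {lo \<tau>..hi \<tau>}"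
      using parts(1)[OF \<tau>] lh by (auto intro: inj_on_subset)
    have "?F (\<sigma> \<circ> \<tau>) = qcost \<alpha> \<beta> M (lo \<tau>) (hi \<tau>) (\<sigma> \<circ> arr (after \<tau>))" if "\<sigma> permutes Y \<tau>" for \<sigma>
      using relabel(3-5)[OF \<tau> that Y1] eq[of "\<sigma> \<circ> \<tau>" \<tau>] lh by (auto intro!: qcost_cong)
    then have "(\<Sum>\<sigma> | \<sigma> permutes Y \<tau>. ?F (\<sigma> \<circ> \<tau>))
        = (\<Sum>\<sigma> | \<sigma> permutes Y \<tau>. qcost \<alpha> \<beta> M (lo \<tau>) (hi \<tau>) (\<sigma> \<circ> arr (after \<tau>)))"
      by simp
    also have "\<dots> = fact (card (Y \<tau>)) * avg_cost \<alpha> \<beta> M (card (Y \<tau>))"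
      using IH[OF _ _ _ inj'] lh unfolding Y[OF \<tau>] by (simp add: card_inj_on_interval[OF inj'])
    finally show ?thesis by simp
  qed
  then show ?thesis
    by (subst sum_permutes_average[OF finite_X, of Y]) (simp_all add: sub inv)
qed

lemma sum_cost_step:
  "(\<Sum>\<tau> | \<tau> permutes X. cost \<alpha> \<beta> (after \<tau>))
    = (\<Sum>\<tau> | \<tau> permutes X. toll \<alpha> \<beta> n (card (small \<tau>)) (card (large \<tau>)))"
proof -
  \<comment> \<open>In contrast to \<open>sum_part\<close>, all values other than the pivots are
    relabelled together. This may exchange small and large ones and alter the run, but it preserves
    both class sizes and the position of \<open>q\<close>, hence the intervals in which the cost
    formula counts.\<close>
  define Y where "Y \<tau> = X - {\<tau> (A left), \<tau> (A right)}" for \<tau> :: "int \<Rightarrow> int"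
  have ends: "A left \<in> X" "A right \<in> X" "A left \<noteq> A right"
    using lr inj_onD[OF inj, of left right] by (auto simp: X_def)
  have fixed: "\<sigma> (\<tau> (A left)) = \<tau> (A left)" "\<sigma> (\<tau> (A right)) = \<tau> (A right)"
    if "\<sigma> permutes Y \<tau>" for \<sigma> \<tau>
    using permutes_not_in[OF that] by (auto simp: Y_def)
  have inv: "Y (\<sigma> \<circ> \<tau>) = Y \<tau>" if "\<sigma> permutes Y \<tau>" for \<sigma> \<tau>
    using fixed[OF that] by (simp add: Y_def)
  have "(\<Sum>\<sigma> | \<sigma> permutes Y \<tau>. cost \<alpha> \<beta> (after (\<sigma> \<circ> \<tau>))) / fact (card (Y \<tau>))
      = toll \<alpha> \<beta> n (card (small \<tau>)) (card (large \<tau>))" if \<tau>: "\<tau> permutes X" for \<tau>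
  proof -
    define S where "S = card (small \<tau>)"
    define L where "L = card (large \<tau>)"
    define N where "N = n - 2"
    have n2: "n = N + 2" using lr by (auto simp: N_def n_def)
    have in_X: "\<tau> (A left) \<in> X" "\<tau> (A right) \<in> X"
      using permutes_in_image[OF \<tau>] ends by auto
    have ne: "\<tau> (A left) \<noteq> \<tau> (A right)"
      using permutes_inj[OF \<tau>] ends by (auto simp: inj_eq)
    have finY: "finite (Y \<tau>)" and cardY: "card (Y \<tau>) = N"
      using finite_X card_X in_X ne by (auto simp: Y_def N_def)
    have mid: "\<tau> (A i) \<in> Y \<tau>" if "i \<in> {left+1..right-1}" for i
    proof -
      have "\<tau> (A i) \<in> X" using that permutes_in_image[OF \<tau>] by (auto simp: X_def)
      moreover have "\<tau> (A i) \<noteq> \<tau> (A left)" "\<tau> (A i) \<noteq> \<tau> (A right)"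
        using that inj_onD[OF permutes_comp_inj_on[OF \<tau> inj], of i left]
          inj_onD[OF permutes_comp_inj_on[OF \<tau> inj], of i right] by auto
      ultimately show ?thesis by (simp add: Y_def)
    qed
    have YS: "{x \<in> Y \<tau>. x < p \<tau>} = small \<tau>" and YL: "{x \<in> Y \<tau>. q \<tau> < x} = large \<tau>"
      by (auto simp: Y_def small_def large_def p_def q_def)
    have SL: "S + L \<le> N"
    proof -
      have "small \<tau> \<inter> large \<tau> = {}" using pivots_less[OF \<tau>] by (auto simp: small_def large_def)
      moreover have "small \<tau> \<union> large \<tau> \<subseteq> Y \<tau>" using YS YL by auto
      ultimately show ?thesis
        using card_mono[OF finY, of "small \<tau> \<union> large \<tau>"] finite_subset[OF _ finY, of "small \<tau>"]
          finite_subset[OF _ finY, of "large \<tau>"]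
        by (simp add: card_Un_disjoint S_def L_def cardY)
    qed
    define g where "g = right - int L"
    have pos_q: "pos_q \<tau> = g" using card_parts(3)[OF \<tau>] by (simp add: g_def L_def)
    have rel: "p (\<sigma> \<circ> \<tau>) = p \<tau>" "q (\<sigma> \<circ> \<tau>) = q \<tau>" "pos_q (\<sigma> \<circ> \<tau>) = g" "\<sigma> \<circ> \<tau> permutes X"
      if \<sigma>: "\<sigma> permutes Y \<tau>" for \<sigma>
    proof -
      show *: "p (\<sigma> \<circ> \<tau>) = p \<tau>" "q (\<sigma> \<circ> \<tau>) = q \<tau>"
        using fixed[OF \<sigma>] by (simp_all add: p_def q_def)
      show perm: "\<sigma> \<circ> \<tau> permutes X"
        using permutes_compose[OF \<tau> permutes_subset[OF \<sigma>]] by (auto simp: Y_def)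
      show "pos_q (\<sigma> \<circ> \<tau>) = g"
        using card_parts(3)[OF perm] * by (simp add: g_def L_def large_def)
    qed
    have small_count: "cnt (\<lambda>i. \<sigma> (\<tau> (A i)) < p \<tau>) (left + 1) (right - 1) = S" if \<sigma>: "\<sigma> permutes Y \<tau>" for \<sigma>
    proof -
      have inj': "inj_on (\<sigma> \<circ> \<tau> \<circ> A) {left..right}"
        using permutes_comp_inj_on[OF rel(4)[OF \<sigma>] inj] by simp
      then have inj'': "inj_on (\<sigma> \<circ> \<tau> \<circ> A) {left+1..right-1}" by (rule inj_on_subset) auto
      have "(\<sigma> \<circ> \<tau> \<circ> A) ` {left+1..right-1} \<subseteq> Y \<tau>"
        using mid permutes_in_image[OF \<sigma>] by auto
      moreover have "card ((\<sigma> \<circ> \<tau> \<circ> A) ` {left+1..right-1}) = card (Y \<tau>)"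
        using card_inj_on_interval[OF inj''] lr by (simp add: cardY N_def n_def)
      ultimately have "(\<sigma> \<circ> \<tau> \<circ> A) ` {left+1..right-1} = Y \<tau>"
        using card_subset_eq[OF finY] by blast
      then show ?thesis using cnt_inj_on[OF inj'', of "\<lambda>x. x < p \<tau>"] by (simp add: YS S_def)
    qed
    have cost: "cost \<alpha> \<beta> (after (\<sigma> \<circ> \<tau>)) = \<alpha> * (2 + real S) + \<beta> * (4 + 2 * real S)
        + (\<alpha> + 2 * \<beta>) * (\<Sum>i\<in>{left+1..min (right-1) g}. of_bool (q \<tau> < \<sigma> (\<tau> (A i))))
        - \<beta> * (\<Sum>i\<in>{g..right-1}. of_bool (\<sigma> (\<tau> (A i)) < p \<tau>))" if \<sigma>: "\<sigma> permutes Y \<tau>" for \<sigma>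
    proof -
      define s' where "s' = after (\<sigma> \<circ> \<tau>)"
      note R = step_result(10,11)[OF rel(4)[OF \<sigma>], folded s'_def]
      have V: "swaps s' = 2 + S + cnt (\<lambda>i. q \<tau> < \<sigma> (\<tau> (A i))) (left + 1) (min (right - 1) g)"
        using R(1) by (simp add: rel[OF \<sigma>] small_count[OF \<sigma>])
      have "writes s' + cnt (\<lambda>i. \<sigma> (\<tau> (A i)) < p \<tau>) g (right - 1)
          = 4 + 2 * S + 2 * cnt (\<lambda>i. q \<tau> < \<sigma> (\<tau> (A i))) (left + 1) (min (right - 1) g)"
        using R(2) by (simp add: rel[OF \<sigma>] small_count[OF \<sigma>])
      \<comment> \<open>The identity for the writes is additive because the counters are natural
        numbers. Over the reals the double swaps can be subtracted.\<close>
      from arg_cong[OF this, of real] have W: "real (writes s') = 4 + 2 * real S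
          + 2 * real (cnt (\<lambda>i. q \<tau> < \<sigma> (\<tau> (A i))) (left + 1) (min (right - 1) g))
          - real (cnt (\<lambda>i. \<sigma> (\<tau> (A i)) < p \<tau>) g (right - 1))"
        by simp
      show ?thesis unfolding s'_def[symmetric] cost_def W V cnt_eq_sum[symmetric]
        by (simp add: algebra_simps)
    qed
    have one: "(\<Sum>\<sigma> | \<sigma> permutes Y \<tau>. \<Sum>i\<in>I. of_bool (P (\<sigma> (\<tau> (A i)))))
        = fact N * (real (card I) * real (card {x \<in> Y \<tau>. P x}) / real N)"
      if I: "I \<subseteq> {left+1..right-1}" for I P
    proof -
      have "(\<Sum>\<sigma> | \<sigma> permutes Y \<tau>. of_bool (P (\<sigma> (\<tau> (A i))))) = fact (N - 1) * real (card {x \<in> Y \<tau>. P x})"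
        if "i \<in> I" for i
        using sum_permutes_one[OF finY mid, of i "\<lambda>x. of_bool (P x)"] that I finY
        by (auto simp: cardY sum_of_bool_eq Int_def)
      then have "(\<Sum>\<sigma> | \<sigma> permutes Y \<tau>. \<Sum>i\<in>I. of_bool (P (\<sigma> (\<tau> (A i)))))
          = real (card I) * (fact (N - 1) * real (card {x \<in> Y \<tau>. P x}))"
        by (subst sum.swap) simp
      \<comment> \<open>If nothing lies between the ends, the quotient is a division by zero and has
        the value 0. This agrees with the empty sum on the left.\<close>
      moreover have "I = {} \<or> N > 0"
      proof (rule disjCI)
        assume "\<not> N > 0"
        then have "right \<le> left + 1" by (simp add: N_def n_def)
        then have "{left+1..right-1} = {}" by simp
        then show "I = {}" using I by simp
      qed
      moreover have "fact N = real N * fact (N - 1)" if "N > 0"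
        using that by (rule fact_reduce)
      ultimately show ?thesis by auto
    qed
    define T where "T = real L * (real N - real L + 1) / real N"
    define U where "U = real L * real S / real N"
    have "(\<Sum>\<sigma> | \<sigma> permutes Y \<tau>. cost \<alpha> \<beta> (after (\<sigma> \<circ> \<tau>)))
        = fact N * (\<alpha> * (2 + real S) + \<beta> * (4 + 2 * real S))
        + (\<alpha> + 2 * \<beta>) * (\<Sum>\<sigma> | \<sigma> permutes Y \<tau>. \<Sum>i\<in>{left+1..min (right-1) g}. of_bool (q \<tau> < \<sigma> (\<tau> (A i))))
        - \<beta> * (\<Sum>\<sigma> | \<sigma> permutes Y \<tau>. \<Sum>i\<in>{g..right-1}. of_bool (\<sigma> (\<tau> (A i)) < p \<tau>))"
      using cost finY by (simp add: sum.distrib sum_subtractf cardY card_permutations flip: sum_distrib_left)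
    also have "(\<Sum>\<sigma> | \<sigma> permutes Y \<tau>. \<Sum>i\<in>{left+1..min (right-1) g}. of_bool (q \<tau> < \<sigma> (\<tau> (A i))))
        = fact N * T"
    proof -
      have "real (card {left+1..min (right-1) g}) * real L = real L * (real N - real L + 1)"
      \<comment> \<open>Without large elements \<open>g\<close> is \<open>right\<close>, and the
        interval has N positions instead of N + 1. The factor \<open>L\<close> makes both products
        0, so one formula covers this case too.\<close>
      proof (cases "L = 0")
        case False
        then have "min (right - 1) g = right - int L" by (simp add: g_def)
        then have "int (card {left+1..min (right-1) g}) = int N - int L + 1"
        proof -
          have "right - left = int N + 1" using n2 lr unfolding n_def by linarith
          then show ?thesis using SL \<open>min (right - 1) g = right - int L\<close> by simp
        qed
        then have "real (card {left+1..min (right-1) g}) = real N - real L + 1"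
          by (metis (mono_tags) of_int_add of_int_diff of_int_of_nat_eq of_int_1)
        then show ?thesis by simp
      qed simp
      moreover have "{left+1..min (right-1) g} \<subseteq> {left+1..right-1}" by auto
      note one[OF this, of "\<lambda>x. q \<tau> < x", unfolded YL L_def[symmetric]]
      ultimately show ?thesis unfolding T_def by (simp only:)
    qed
    also have "(\<Sum>\<sigma> | \<sigma> permutes Y \<tau>. \<Sum>i\<in>{g..right-1}. of_bool (\<sigma> (\<tau> (A i)) < p \<tau>))
        = fact N * U"
    proof -
      have "{g..right-1} \<subseteq> {left+1..right-1}" using SL n2 lr by (auto simp: g_def n_def)
      note one[OF this, of "\<lambda>x. x < p \<tau>", unfolded YS S_def[symmetric]]
      moreover have "card {g..right-1} = L" by (simp add: g_def)
      ultimately show ?thesis unfolding U_def by (simp only:)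
    qed
    also have "fact N * (\<alpha> * (2 + real S) + \<beta> * (4 + 2 * real S)) + (\<alpha> + 2 * \<beta>) * (fact N * T)
        - \<beta> * (fact N * U) = fact N * (\<alpha> * (2 + real S + T) + \<beta> * (4 + 2 * real S + 2 * T - U))"
      by (simp add: algebra_simps)
    also have "\<alpha> * (2 + real S + T) + \<beta> * (4 + 2 * real S + 2 * T - U) = toll \<alpha> \<beta> n S L"
      by (simp add: toll_def Let_def n2 T_def U_def)
    finally show ?thesis by (simp add: cardY S_def L_def comp_def)
  qed
  then show ?thesis
    by (subst sum_permutes_average[OF finite_X, of Y]) (simp_all add: inv, auto simp: Y_def)
qed

end

lemma (in partitioning) sum_ranks:
  fixes h :: "nat \<Rightarrow> nat \<Rightarrow> nat \<Rightarrow> real"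
  shows "(\<Sum>\<tau> | \<tau> permutes X. h (card (small \<tau>)) (card (medium \<tau>)) (card (large \<tau>)))
    = fact (n - 2) * (2 * (\<Sum>j<n. \<Sum>i<j. h i (j - i - 1) (n - 1 - j)))"
proof -
  have ends: "A left \<in> X" "A right \<in> X" "A left \<noteq> A right"
    using lr inj_onD[OF inj, of left right] by (auto simp: X_def)
  show ?thesis
    using sum_permutes_two[OF finite_X ends, of "\<lambda>a b. h (card {x \<in> X. x < min a b})
      (card {x \<in> X. min a b < x \<and> x < max a b}) (card {x \<in> X. max a b < x})"]
    unfolding small_def medium_def large_def p_def q_def sum_pairs_by_rank[OF finite_X] card_X .
qed

text \<open>Stated for any injective array on any interval, since a subarray may sit anywhere and
  carry any set of values. The original problem is \<open>A = id\<close> on the positions 1 to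
  n.\<close>

lemma sum_qcost:
  assumes "1 \<le> M" "inj_on A {left..right}"
  shows "(\<Sum>\<tau> | \<tau> permutes A ` {left..right}. qcost \<alpha> \<beta> M left right (\<tau> \<circ> A))
    = fact (nat (right + 1 - left)) * avg_cost \<alpha> \<beta> M (nat (right + 1 - left))"
  using assms(2)
proof (induction "nat (right + 1 - left)" arbitrary: A left right rule: less_induct)
  case less
  define n where "n = nat (right + 1 - left)"
  show ?case
  proof (cases "n \<le> M")
    case True
    then show ?thesis using sum_insertion_sort[OF less.prems n_def, of M \<alpha> \<beta>]
      by (simp add: avg_cost.simps[of _ _ _ n] n_def[symmetric]) (simp add: n_def)
  next
    case False
    interpret partitioning A left right n
      using less.prems False assms(1) by unfold_locales (auto simp: n_def)
    have big: "\<not> right - left < int M" using False by (simp add: n_def)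
    have n2: "2 \<le> n" using False assms(1) by simp
    note IH = less.hyps[folded n_def]
    have "(\<Sum>\<tau> | \<tau> permutes X. qcost \<alpha> \<beta> M left right (\<tau> \<circ> A)) = (\<Sum>\<tau> | \<tau> permutes X.
        cost \<alpha> \<beta> (after \<tau>) + qcost \<alpha> \<beta> M left (pos_p \<tau> - 1) (arr (after \<tau>))
        + qcost \<alpha> \<beta> M (pos_p \<tau> + 1) (pos_q \<tau> - 1) (arr (after \<tau>)) + qcost \<alpha> \<beta> M (pos_q \<tau> + 1) right (arr (after \<tau>)))"
      using step_result(3) by (intro sum.cong refl qcost_partition[OF big step_eq]) auto
    also have "\<dots> = (\<Sum>\<tau> | \<tau> permutes X. toll \<alpha> \<beta> n (card (small \<tau>)) (card (large \<tau>)))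
        + (\<Sum>\<tau> | \<tau> permutes X. avg_cost \<alpha> \<beta> M (card (small \<tau>)))
        + (\<Sum>\<tau> | \<tau> permutes X. avg_cost \<alpha> \<beta> M (card (medium \<tau>)))
        + (\<Sum>\<tau> | \<tau> permutes X. avg_cost \<alpha> \<beta> M (card (large \<tau>)))"
    proof -
      have b: "left \<le> pos_p \<tau> \<and> pos_p \<tau> < pos_q \<tau> \<and> pos_q \<tau> \<le> right" if "\<tau> permutes X" for \<tau>
        using step_result(2-4)[OF that] by simp
      have "(\<Sum>\<tau> | \<tau> permutes X. qcost \<alpha> \<beta> M left (pos_p \<tau> - 1) (arr (after \<tau>)))
          = (\<Sum>\<tau> | \<tau> permutes X. avg_cost \<alpha> \<beta> M (card (small \<tau>)))"
        by (rule sum_part[OF IH]) (use b lr in \<open>auto simp: parts n_def dest: b\<close>)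
      moreover have "(\<Sum>\<tau> | \<tau> permutes X. qcost \<alpha> \<beta> M (pos_p \<tau> + 1) (pos_q \<tau> - 1) (arr (after \<tau>)))
          = (\<Sum>\<tau> | \<tau> permutes X. avg_cost \<alpha> \<beta> M (card (medium \<tau>)))"
        by (rule sum_part[OF IH]) (use b lr in \<open>auto simp: parts n_def dest: b\<close>)
      moreover have "(\<Sum>\<tau> | \<tau> permutes X. qcost \<alpha> \<beta> M (pos_q \<tau> + 1) right (arr (after \<tau>)))
          = (\<Sum>\<tau> | \<tau> permutes X. avg_cost \<alpha> \<beta> M (card (large \<tau>)))"
        by (rule sum_part[OF IH]) (use b lr in \<open>auto simp: parts n_def dest: b\<close>)
      ultimately show ?thesis by (simp add: sum.distrib sum_cost_step)
    qed
    also have "\<dots> = (\<Sum>\<tau> | \<tau> permutes X. toll \<alpha> \<beta> n (card (small \<tau>)) (card (large \<tau>))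
        + (avg_cost \<alpha> \<beta> M (card (small \<tau>)) + avg_cost \<alpha> \<beta> M (card (medium \<tau>))
        + avg_cost \<alpha> \<beta> M (card (large \<tau>))))"
      by (simp add: sum.distrib)
    also have "\<dots> = fact (n - 2) * (2 * (\<Sum>j<n. \<Sum>i<j. toll \<alpha> \<beta> n i (n - 1 - j)
        + (avg_cost \<alpha> \<beta> M i + avg_cost \<alpha> \<beta> M (j - i - 1) + avg_cost \<alpha> \<beta> M (n - 1 - j))))"
      by (rule sum_ranks)
    also have "\<dots> = fact (n - 2) * (real n * (real n - 1) * mean_toll \<alpha> \<beta> n
        + 6 * (\<Sum>k<n. real (n - 1 - k) * avg_cost \<alpha> \<beta> M k))"
      unfolding sum.distrib[of "\<lambda>i. toll \<alpha> \<beta> n i _"] sum.distrib[of "\<lambda>j. \<Sum>i<j. toll \<alpha> \<beta> n i (n - 1 - j)"]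
        sum_three_parts sum_toll[OF n2] by simp
    also have "\<dots> = fact n * avg_cost \<alpha> \<beta> M n"
    proof -
      define N where "N = n - 2"
      have n: "n = Suc (Suc N)" using n2 by (simp add: N_def)
      have "fact n = real n * (real n - 1) * fact (n - 2)" by (simp add: n)
      then show ?thesis using False n2
        by (simp add: avg_cost.simps[of _ _ _ n] distrib_left)
    qed
    finally show ?thesis by (simp only: X_def n_def)
  qed
qed

section \<open>From sums over relabellings to expectations\<close>

lemma expectation_quicksort:
  assumes "1 \<le> M"
  shows "measure_pmf.expectation (random_perm n) (\<lambda>\<pi>. cost \<alpha> \<beta> (run_quicksort M n \<pi>)) = avg_cost \<alpha> \<beta> M n"
proof -
  let ?P = "{\<pi>. \<pi> permutes {1..int n}}"
  have fin: "finite ?P" by (rule finite_permutations) simp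
  have ne: "?P \<noteq> {}" using permutes_id by blast
  have "measure_pmf.expectation (random_perm n) (\<lambda>\<pi>. cost \<alpha> \<beta> (run_quicksort M n \<pi>))
      = (\<Sum>\<pi>\<in>?P. qcost \<alpha> \<beta> M 1 (int n) (\<pi> \<circ> id)) / card ?P"
    unfolding random_perm_def using fin ne
    by (simp add: integral_pmf_of_set qcost_def run_quicksort_def initial_def)
  also have "\<dots> = avg_cost \<alpha> \<beta> M n"
    using sum_qcost[OF assms inj_on_id, where left = 1 and right = "int n" and \<alpha> = \<alpha> and \<beta> = \<beta>] by (simp add: card_permutations)
  finally show ?thesis .
qed

lemma expected_swaps_eq: "1 \<le> M \<Longrightarrow> expected_swaps M n = avg_cost 1 0 M n"
  and expected_writes_eq: "1 \<le> M \<Longrightarrow> expected_writes M n = avg_cost 0 1 M n"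
  using expectation_quicksort[of M n, where \<alpha> = 1 and \<beta> = 0]
    expectation_quicksort[of M n, where \<alpha> = 0 and \<beta> = 1]
  by (simp_all add: expected_swaps_def expected_writes_def cost_def)

subsection \<open>Solving the recurrence\<close>

text \<open>From these \<open>n\<close> on, partitioning takes place and the toll is linear. After
  multiplication by n(n-1), the weighted sum \<open>T\<close> has second difference
  \<open>E n\<close>, and n(n-1) - 6 = (n-3)(n+2) gives the last coefficient.\<close>

lemma avg_cost_recurrence:
  fixes \<alpha> \<beta> :: real and M n :: nat
  assumes n: "M < n" "3 \<le> n"
  defines "E \<equiv> avg_cost \<alpha> \<beta> M"
    and "a \<equiv> \<alpha> / 2 + 11/12 * \<beta>" and "b \<equiv> 7/6 * \<alpha> + 31/12 * \<beta>"
  shows "(real n + 2) * (real n + 1) * E (n + 2) - 2 * (real n + 1) * real n * E (n + 1)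
    + (real n - 3) * (real n + 2) * E n = a * (6 * real n + 4) + 2 * b"
proof -
  define T where "T n = (\<Sum>k<n. real (n - 1 - k) * E k)" for n
  have E: "real m * (real m - 1) * E m = real m * (real m - 1) * (a * real m + b) + 6 * T m"
    if "n \<le> m" for m
  proof -
    have "E m = a * real m + b + 6 / (real m * (real m - 1)) * T m"
      using n that unfolding E_def T_def a_def b_def
      by (subst avg_cost.simps) (simp add: mean_toll_def algebra_simps)
    moreover have "real m * (real m - 1) \<noteq> 0" using n that by auto
    ultimately show ?thesis by (simp add: field_simps)
  qed
  have T: "T (Suc m) = T m + (\<Sum>k<m. E k)" for m
    unfolding T_def by (rule sum_weighted_Suc)
  have "T (n + 2) - 2 * T (n + 1) + T n = E n"
    by (simp add: T)
  then show ?thesis using E[of n] E[of "n + 1"] E[of "n + 2"] by (simp add: algebra_simps)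
qed

text \<open>The operator on the left of \<open>avg_cost_recurrence\<close> sends (n+1) H_{n+1} to
  5(n+1), the constant 1 to -4 and n + 1 to 0. Since a(6n+4) + 2b = 6a(n+1) - 2(a-b), this forces
  the coefficients 6/5 a and (a-b)/2 and leaves \<open>c\<close> free.\<close>

definition quicksort_form :: "real \<Rightarrow> real \<Rightarrow> real \<Rightarrow> nat \<Rightarrow> real" where
  "quicksort_form a b c n = 6/5 * a * (real (n + 1) * harm (n + 1)) + c * real (n + 1) + (a - b) / 2"

lemma quicksort_form_recurrence:
  "(real n + 2) * (real n + 1) * quicksort_form a b c (n + 2)
     - 2 * (real n + 1) * real n * quicksort_form a b c (n + 1)
     + (real n - 3) * (real n + 2) * quicksort_form a b c n = a * (6 * real n + 4) + 2 * b"
proof -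
  define h where "h = (harm (n + 1) :: real)"
  define x where "x = real n"
  have "harm (n + 2) = h + 1 / (x + 2)" "harm (n + 3) = h + 1 / (x + 2) + 1 / (x + 3)"
    by (simp_all add: harm_Suc h_def x_def eval_nat_numeral divide_inverse add.commute)
  then have "quicksort_form a b c (n + 2) = 6/5 * a * ((x + 3) * (h + 1 / (x + 2) + 1 / (x + 3))) + c * (x + 3) + (a - b) / 2"
    "quicksort_form a b c (n + 1) = 6/5 * a * ((x + 2) * (h + 1 / (x + 2))) + c * (x + 2) + (a - b) / 2"
    "quicksort_form a b c n = 6/5 * a * ((x + 1) * h) + c * (x + 1) + (a - b) / 2"
    by (simp_all add: quicksort_form_def h_def x_def add.commute eval_nat_numeral)
  moreover have "x + 2 \<noteq> 0" "x + 3 \<noteq> 0" by (simp_all add: x_def)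
  ultimately show ?thesis unfolding x_def[symmetric]
    by (simp add: divide_simps) algebra
qed

text \<open>The condition at \<open>n\<^sub>0\<close> excludes the solution \<open>n + 1\<close>, and what remains satisfies a
  first-order recurrence.\<close>

lemma homogeneous_recurrence:
  fixes D :: "nat \<Rightarrow> real"
  assumes rec: "\<And>n. n0 \<le> n \<Longrightarrow> (real n + 2) * (real n + 1) * D (n + 2)
      - 2 * (real n + 1) * real n * D (n + 1) + (real n - 3) * (real n + 2) * D n = 0"
    and base: "(real n0 + 1) * D (n0 + 1) = (real n0 - 3) * D n0" and "n0 \<le> n"
  shows "(real n + 1) * D (n + 1) = (real n - 3) * D n"
  using \<open>n0 \<le> n\<close>
proof (induction n rule: dec_induct)
  case (step n)
  \<comment> \<open>With R n = (n+1) D(n+1) - (n-3) D n, the second-order recurrence says (n+1)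
    R(n+1) = (n+2) R n. So R stays 0 once it is 0.\<close>
  have "(real n + 1) * ((real n + 2) * D (n + 2)) = (real n + 1) * ((real n - 2) * D (n + 1))"
    using rec[OF step.hyps(1)] step.IH by algebra
  then have "(real n + 2) * D (n + 2) = (real n - 2) * D (n + 1)"
    using mult_cancel_left[of "real n + 1"] by auto
  then show ?case by (simp add: algebra_simps)
qed (rule base)

text \<open>The product of \<open>D n\<close> with \<open>u n\<close> = n(n-1)(n-2)(n-3) is
  invariant under the recurrence, hence constant.\<close>

lemma homogeneous_bigo:
  fixes D :: "nat \<Rightarrow> real"
  assumes rec: "\<And>n. n0 \<le> n \<Longrightarrow> (real n + 1) * D (n + 1) = (real n - 3) * D n"
  shows "D \<in> O(\<lambda>n. 1 / real n ^ 4)"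
proof -
  define u where "u n = real n * (real n - 1) * (real n - 2) * (real n - 3)" for n
  have const: "u n * D n = u n0 * D n0" if "n0 \<le> n" for n
    using that
  proof (induction n rule: dec_induct)
    case (step n)
    have "u (Suc n) * D (Suc n) = u n * D n"
    proof -
      have "u (Suc n) * D (Suc n) = real n * (real n - 1) * (real n - 2) * ((real n + 1) * D (n + 1))"
        by (simp add: u_def)
      then show ?thesis unfolding rec[OF step.hyps(1)] by (simp add: u_def)
    qed
    then show ?case using step.IH by simp
  qed simp
  \<comment> \<open>For n at least 6 each of n-1, n-2 and n-3 is at least n/2, whence the factor
    8.\<close>
  have "norm (D n) \<le> 8 * \<bar>u n0 * D n0\<bar> * norm (1 / real n ^ 4)" if "max 6 n0 \<le> n" for n
  proof -
    define x where "x = real n"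
    have x: "6 \<le> x" using that by (simp add: x_def)
    have "x * (x / 2) * (x / 2) * (x / 2) \<le> x * (x - 1) * (x - 2) * (x - 3)"
      using x by (intro mult_mono) auto
    then have u: "x ^ 4 / 8 \<le> u n" by (simp add: u_def x_def power4_eq_xxxx)
    have pos: "0 < x ^ 4 / 8" using x by simp
    have "x ^ 4 / 8 * \<bar>D n\<bar> \<le> u n * \<bar>D n\<bar>" using u by (rule mult_right_mono) simp
    also have "0 \<le> u n" using u pos by linarith
    then have "u n * \<bar>D n\<bar> = \<bar>u n * D n\<bar>" by (simp add: abs_mult)
    also have "\<dots> = \<bar>u n0 * D n0\<bar>" using const[of n] that by simp
    finally show ?thesis using pos by (simp add: x_def[symmetric] field_simps)
  qed
  then show ?thesis by (intro bigoI eventually_sequentiallyI)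
qed

text \<open>The hypothesis \<open>base\<close> is a linear condition on \<open>c\<close>, and it
  selects the right multiple of n + 1. The start is \<open>M + 1\<close> for \<open>M\<close> at
  least 2, but 3 for \<open>M = 1\<close>, where the toll at 2 is exceptional.\<close>

lemma avg_cost_first_order:
  fixes \<alpha> \<beta> c :: real and M :: nat
  defines "a \<equiv> \<alpha> / 2 + 11/12 * \<beta>" and "b \<equiv> 7/6 * \<alpha> + 31/12 * \<beta>"
  defines "D \<equiv> \<lambda>n. avg_cost \<alpha> \<beta> M n - quicksort_form a b c n"
  assumes n0: "M < n0" "3 \<le> n0"
    and base: "(real n0 + 1) * D (n0 + 1) = (real n0 - 3) * D n0" and n: "n0 \<le> n"
  shows "(real n + 1) * D (n + 1) = (real n - 3) * D n"
proof (rule homogeneous_recurrence[OF _ base n])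
  fix m assume "n0 \<le> m"
  then have "M < m" "3 \<le> m" using n0 by auto
  then show "(real m + 2) * (real m + 1) * D (m + 2) - 2 * (real m + 1) * real m * D (m + 1)
      + (real m - 3) * (real m + 2) * D m = 0"
    using avg_cost_recurrence[of M m \<alpha> \<beta>] quicksort_form_recurrence[of m a b c]
    unfolding D_def a_def b_def by (simp add: algebra_simps)
qed

section \<open>Initial values and the coefficient of n + 1\<close>

definition insertion_weight :: "real \<Rightarrow> real" where
  "insertion_weight x = (x + 1) * x * (x - 1) * (x - 2) / 48 + (x + 1) * x * (x - 1) / 6
     - (x + 1) * x / 2 + x"

text \<open>The inversions give half of the binomial coefficient of n + 1 over 4. The final writes
  give n + 1 over 3 less n + 1 over 2, and the last summand n corrects the term for k = 0, where
  \<open>k - 1\<close> is truncated to 0.\<close>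

lemma sum_insertion_costs:
  "(\<Sum>k<Suc n. real (Suc n - 1 - k) * (real k * (real k - 1) / 4 + real (k - 1)))
    = insertion_weight (real n)"
proof (induction n)
  case (Suc n)
  have "(\<Sum>k<Suc n. real k * (real k - 1) / 4 + real (k - 1))
      = (real n + 1) * real n * (real n - 1) / 12 + real n * (real n - 1) / 2"
  proof (induction n)
    case (Suc n)
    then show ?case by (simp add: field_simps)
  qed simp
  then show ?case unfolding sum_weighted_Suc[of "Suc n"] Suc.IH
    by (simp add: insertion_weight_def field_simps)
qed (simp add: insertion_weight_def)

lemma avg_cost_base:
  assumes "M \<le> n" "n \<le> M + 1"
  shows "avg_cost \<alpha> \<beta> M (Suc n) = mean_toll \<alpha> \<beta> (Suc n)
    + 6 / ((real n + 1) * real n) * (\<beta> * insertion_weight (real n))"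
proof -
  have "(\<Sum>k<Suc n. real (Suc n - 1 - k) * avg_cost \<alpha> \<beta> M k) =
      \<beta> * (\<Sum>k<Suc n. real (Suc n - 1 - k) * (real k * (real k - 1) / 4 + real (k - 1)))"
    unfolding sum_distrib_left
  proof (intro sum.cong refl)
    fix k assume k: "k \<in> {..<Suc n}"
    show "real (Suc n - 1 - k) * avg_cost \<alpha> \<beta> M k
        = \<beta> * (real (Suc n - 1 - k) * (real k * (real k - 1) / 4 + real (k - 1)))"
    proof (cases "k \<le> M")
      case True
      then show ?thesis by (subst avg_cost.simps) simp
    next
      case False
      \<comment> \<open>The only size above \<open>M\<close> in this range is k = n, and it has
        weight 0: two elements are used up as pivots. Hence the costs at \<open>M + 1\<close> and at
        \<open>M + 2\<close> both depend on Insertionsort alone.\<close>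
      then have "Suc n - 1 - k = 0" using k assms by auto
      then show ?thesis by simp
    qed
  qed
  note T = this[unfolded sum_insertion_costs]
  have "avg_cost \<alpha> \<beta> M (Suc n) = mean_toll \<alpha> \<beta> (Suc n) + 6 / (real (Suc n) * (real (Suc n) - 1))
      * (\<Sum>k<Suc n. real (Suc n - 1 - k) * avg_cost \<alpha> \<beta> M k)"
    using assms(1) by (intro trans[OF avg_cost.simps if_not_P]) simp
  then show ?thesis unfolding T by (simp add: add.commute)
qed

text \<open>\<open>C\<close> is the solution of the linear equation \<open>base\<close>, that is
  (M+2) D(M+2) = (M-2) D(M+1). The coefficient passed to \<open>quicksort_form\<close> is
  \<open>C - 6/5 * a * h\<close>, which absorbs the subtracted harmonic number.\<close>

lemma avg_cost_bigo:
  fixes \<alpha> \<beta> C :: real and M :: nat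
  assumes "2 \<le> M"
  defines "a \<equiv> \<alpha> / 2 + 11/12 * \<beta>" and "b \<equiv> 7/6 * \<alpha> + 31/12 * \<beta>" 
  assumes C: "C = \<alpha> * (19/50 + 4 / (5 * real (M + 2)))
    + \<beta> * (86/75 + 3/20 * real M + 18 / (5 * real (M + 1)) - 26 / (5 * real (M + 2)))"
  shows "(\<lambda>n. avg_cost \<alpha> \<beta> M n - (6/5 * a * real (n + 1) * (harm (n + 1) - harm (M + 2))
    + C * real (n + 1) + (a - b) / 2)) \<in> O(\<lambda>n. 1 / real n ^ 4)"
proof -
  define h where "h = (harm (M + 2) :: real)"
  define D where "D n = avg_cost \<alpha> \<beta> M n - quicksort_form a b (C - 6/5 * a * h) n" for n
  define x where "x = real M"
  have x: "x > 0" "real (M + 1) = x + 1" "real (M + 2) = x + 2"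
    using assms(1) by (simp_all add: x_def)
  have h: "harm (Suc (Suc M)) = h" by (simp add: h_def)
  have t: "mean_toll \<alpha> \<beta> (Suc M) = a * (x + 1) + b" "mean_toll \<alpha> \<beta> (Suc (Suc M)) = a * (x + 2) + b"
    using assms(1) by (auto simp: mean_toll_def a_def b_def x_def field_simps)
  have "harm (M + 3) = h + 1 / (x + 3)"
    by (simp add: harm_Suc h_def x_def eval_nat_numeral divide_inverse add.commute)
  then have F: "quicksort_form a b (C - 6/5 * a * h) (M + 1) = C * (x + 2) + (a - b) / 2"
    "quicksort_form a b (C - 6/5 * a * h) (M + 2) = C * (x + 3) + 6/5 * a + (a - b) / 2"
    using x by (auto simp: quicksort_form_def h x_def[symmetric] eval_nat_numeral field_simps)
  have D1: "D (M + 1) = a * (x + 1) + b + 6 / ((x + 1) * x) * (\<beta> * insertion_weight x)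
      - (C * (x + 2) + (a - b) / 2)"
    using avg_cost_base[of M M \<alpha> \<beta>] F(1) t(1) by (simp add: D_def x_def)
  have D2: "D (M + 2) = a * (x + 2) + b + 6 / ((x + 2) * (x + 1)) * (\<beta> * insertion_weight (x + 1))
      - (C * (x + 3) + 6/5 * a + (a - b) / 2)"
    using avg_cost_base[of M "M + 1" \<alpha> \<beta>] F(2) t(2) by (simp add: D_def x_def add.commute)
  have base: "(x + 2) * D (M + 2) = (x - 2) * D (M + 1)"
    unfolding D1 D2 C insertion_weight_def a_def b_def x(2,3) x_def[symmetric] using x(1)
    by (simp add: divide_simps) algebra
  have "(real n + 1) * D (n + 1) = (real n - 3) * D n" if "M + 1 \<le> n" for n
    using avg_cost_first_order[of M "M + 1" \<alpha> \<beta> "C - 6/5 * a * h" n] base that assms(1)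
    unfolding D_def a_def b_def x_def by (simp add: algebra_simps)
  then have "D \<in> O(\<lambda>n. 1 / real n ^ 4)" by (rule homogeneous_bigo)
  moreover have "D = (\<lambda>n. avg_cost \<alpha> \<beta> M n - (6/5 * a * real (n + 1) * (harm (n + 1) - harm (M + 2))
    + C * real (n + 1) + (a - b) / 2))"
    by (rule ext) (simp add: D_def quicksort_form_def h field_simps)
  ultimately show ?thesis by (simp only:)
qed

text \<open>At 3 the condition on \<open>D\<close> reads 4 D(4) = 0, whatever D(3) is. It determines
  the coefficient of n + 1, and the first-order recurrence then keeps \<open>D\<close> at 0 from 4
  on.\<close>

lemma avg_cost_1:
  fixes \<alpha> \<beta> :: real and n :: nat
  defines "a \<equiv> \<alpha> / 2 + 11/12 * \<beta>" and "b \<equiv> 7/6 * \<alpha> + 31/12 * \<beta>"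
  assumes "4 \<le> n"
  shows "avg_cost \<alpha> \<beta> 1 n = quicksort_form a b (- (47/100 * \<alpha> + 139/200 * \<beta>)) n"
proof -
  define D where "D n = avg_cost \<alpha> \<beta> 1 n - quicksort_form a b (- (47/100 * \<alpha> + 139/200 * \<beta>)) n" for n
  have E: "avg_cost \<alpha> \<beta> 1 0 = 0" "avg_cost \<alpha> \<beta> 1 1 = 0" "avg_cost \<alpha> \<beta> 1 2 = 2 * \<alpha> + 4 * \<beta>"
  proof -
    have "{..<2::nat} = {0, 1}" by auto
    then show "avg_cost \<alpha> \<beta> 1 2 = 2 * \<alpha> + 4 * \<beta>"
      by (subst avg_cost.simps) (simp add: mean_toll_def avg_cost.simps[of _ _ _ 0])
  qed (subst avg_cost.simps; simp)+
  have "avg_cost \<alpha> \<beta> 1 4 = mean_toll \<alpha> \<beta> 4 + (2 * \<alpha> + 4 * \<beta>) / 2"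
  proof -
    \<comment> \<open>Sizes 0 and 1 cost nothing and size 3 has weight 0, so only size 2
      contributes, with the factor 6/12.\<close>
    have "{..<4::nat} = {0, 1, 2, 3}" by auto
    then show ?thesis by (subst avg_cost.simps) (simp add: E[unfolded One_nat_def])
  qed
  moreover have "quicksort_form a b c 4 = 6/5 * a * (137/12) + 5 * c + (a - b) / 2" for c
    by (simp add: quicksort_form_def harm_Suc eval_nat_numeral harm_def)
  ultimately have D4: "D 4 = 0"
    unfolding D_def by (simp only:) (simp add: mean_toll_def a_def b_def field_simps)
  have rec: "(real n + 1) * D (n + 1) = (real n - 3) * D n" if "4 \<le> n" for n
    using avg_cost_first_order[of 1 3 \<alpha> \<beta> _ n] D4 that unfolding D_def a_def b_def by simp
  have "D n = 0" using \<open>4 \<le> n\<close>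
  proof (induction n rule: dec_induct)
    case (step n)
    then show ?case using rec[of n] by simp
  qed (rule D4)
  then show ?thesis by (simp add: D_def)
qed

theorem theorem3p9:
  fixes M :: nat
  assumes "M \<ge> 1"
  shows
    "(M \<ge> 2 \<longrightarrow>
       (\<lambda>n. expected_swaps M n
          - (3/5 * real (n + 1) * (harm (n + 1) - harm (M + 2))
             + (19/50 + 4 / (5 * real (M + 2))) * real (n + 1) - 1/3))
         \<in> O(\<lambda>n. 1 / real n ^ 4)
     \<and> (\<lambda>n. expected_writes M n
          - (11/10 * real (n + 1) * (harm (n + 1) - harm (M + 2))
             + (86/75 + 3/20 * real M + 18 / (5 * real (M + 1)) - 26 / (5 * real (M + 2)))
                 * real (n + 1) - 5/6))
         \<in> O(\<lambda>n. 1 / real n ^ 4))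
   \<and> (M = 1 \<longrightarrow>
       (\<forall>n\<ge>4.
          expected_swaps M n = 3/5 * real (n + 1) * harm n - 47/100 * real n - 61/300
        \<and> expected_writes M n = 11/10 * real (n + 1) * harm n - 139/200 * real n - 257/600))"
proof (intro conjI impI allI)
  assume M: "M \<ge> 2"
  show "(\<lambda>n. expected_swaps M n
          - (3/5 * real (n + 1) * (harm (n + 1) - harm (M + 2))
             + (19/50 + 4 / (5 * real (M + 2))) * real (n + 1) - 1/3))
         \<in> O(\<lambda>n. 1 / real n ^ 4)"
    using avg_cost_bigo[OF M refl, of 1 0] by (simp add: expected_swaps_eq[OF assms])
  show "(\<lambda>n. expected_writes M n
          - (11/10 * real (n + 1) * (harm (n + 1) - harm (M + 2))
             + (86/75 + 3/20 * real M + 18 / (5 * real (M + 1)) - 26 / (5 * real (M + 2)))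
                 * real (n + 1) - 5/6))
         \<in> O(\<lambda>n. 1 / real n ^ 4)"
    using avg_cost_bigo[OF M refl, of 0 1] by (simp add: expected_writes_eq[OF assms])
next
  fix n :: nat assume M: "M = 1" and n: "4 \<le> n"
  \<comment> \<open>Passing from H_{n+1} to H_n adds 3/5 or 11/10 to the constant. Indeed 3/5 -
    47/100 - 1/3 = -61/300 and 11/10 - 139/200 - 5/6 = -257/600.\<close>
  have h: "real (n + 1) * harm (n + 1) = real (n + 1) * harm n + 1"
    by (simp add: harm_Suc field_simps)
  have "expected_swaps M n = 3/5 * (real (n + 1) * harm (n + 1)) - 47/100 * real (n + 1) - 1/3"
    "expected_writes M n = 11/10 * (real (n + 1) * harm (n + 1)) - 139/200 * real (n + 1) - 5/6"
    using avg_cost_1[OF n, of 1 0] avg_cost_1[OF n, of 0 1]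
    by (simp_all add: expected_swaps_eq expected_writes_eq M quicksort_form_def)
  then show "expected_swaps M n = 3/5 * real (n + 1) * harm n - 47/100 * real n - 61/300"
    "expected_writes M n = 11/10 * real (n + 1) * harm n - 139/200 * real n - 257/600"
    unfolding h by (simp_all add: field_simps)
qed

end
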